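(* For each $1\le n\le\omega$ and every comeager set $C\subseteq X_n$, $F_n\le_B F_n\restriction C$.
   Context: Let $\mathbb N=\{0,1,2,\dots\}$ and identify $2^{\mathbb N}$ with $\mathcal P(\mathbb N)$. For $1\le m\le\omega$ and $x\in((2^{\mathbb N})^{\mathbb N})^m$ define recursively: $A^x_1=\{x(0)(k):k\in\mathbb N\}\subseteq 2^{\mathbb N}$; for $1\le j<m$ and $l\in\mathbb N$, $a^{x,l}_1=\{x(0)(k):x(1)(l)(k)=1\}$ and $a^{x,l}_{j}=\{a^{x,k}_{j-1}:x(j)(l)(k)=1\}$ for $j\ge 2$; and $A^x_{j+1}=\{a^{x,k}_j:k\in\mathbb N\}$ for $1\le j<m$. Let $X_1=(2^{\mathbb N})^{\mathbb N}$, and for $2\le n\le\omega$ let $X_n$ be the set of $x\in((2^{\mathbb N})^{\mathbb N})^n$ such that for every $1\le i<n$: (1) for every $m$ there is $k$ with $x(i)(k)(m)=1$; (2) for every $k$ there is $m$ with $x(i)(k)(m)=1$; (3) for all $k,l_1,l_2$, if $x(i-1)(l_1)=x(i-1)(l_2)$ then $x(i)(k)(l_1)=x(i)(k)(l_2)$. For $1\le n<\omega$, $F_n$ on $X_n$ is $x\mathrel{F_n}y\iff A^x_n=A^y_n$; $F_\omega$ on $X_\omega$ is $x\mathrel{F_\omega}y\iff A^x_j=A^y_j$ for all $1\le j<\omega$. *)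

theory Defs
  imports "HOL-Analysis.Analysis" "HOL-Library.Extended_Nat" "HOL-Library.Countable_Set_Type"
begin

text \<open>Points of 2^N are functions nat => bool (True = 1).  A point of
  ((2^N)^N)^n is a function x :: nat => nat => nat => bool, where x i k m = x(i)(k)(m);
  the index i ranges over {i. enat i < n} (extensional: undefined outside).\<close>

type_synonym pt = "nat \<Rightarrow> nat \<Rightarrow> nat \<Rightarrow> bool"

text \<open>Hereditarily countable sets over urelements from 2^N, used to express the
  sets A^x_j (which live at different set-theoretic levels) in a single type.\<close>
datatype hs = Atom "nat \<Rightarrow> bool" | HSet "hs cset"

fun aa :: "pt \<Rightarrow> nat \<Rightarrow> nat \<Rightarrow> hs" where
  "aa x 0 l = Atom (x 0 l)"
| "aa x (Suc j) l = HSet (acset {aa x j k | k. x (Suc j) l k})"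

text \<open>AA x (Suc j) = A^x_{j+1}, so AA x 1 = {x(0)(k) : k}.\<close>
definition AA :: "pt \<Rightarrow> nat \<Rightarrow> hs" where
  "AA x j = HSet (acset (range (aa x (j - 1))))"

definition cantor_top :: "(nat \<Rightarrow> bool) topology" where
  "cantor_top = product_topology (\<lambda>_. discrete_topology UNIV) UNIV"

definition seq_top :: "(nat \<Rightarrow> nat \<Rightarrow> bool) topology" where
  "seq_top = product_topology (\<lambda>_. cantor_top) UNIV"

definition ambient_top :: "enat \<Rightarrow> pt topology" where
  "ambient_top n = product_topology (\<lambda>_. seq_top) {i. enat i < n}"

definition Xset :: "enat \<Rightarrow> pt set" where
  "Xset n = {x \<in> topspace (ambient_top n).
     \<forall>i. 1 \<le> i \<and> enat i < n \<longrightarrow>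
        (\<forall>m. \<exists>k. x i k m) \<and>
        (\<forall>k. \<exists>m. x i k m) \<and>
        (\<forall>k l1 l2. x (i - 1) l1 = x (i - 1) l2 \<longrightarrow> x i k l1 = x i k l2)}"

definition Xtop :: "enat \<Rightarrow> pt topology" where
  "Xtop n = subtopology (ambient_top n) (Xset n)"

definition FF :: "enat \<Rightarrow> pt \<Rightarrow> pt \<Rightarrow> bool" where
  "FF n x y = (case n of enat m \<Rightarrow> AA x m = AA y m
                       | \<infinity> \<Rightarrow> (\<forall>j. 1 \<le> j \<longrightarrow> AA x j = AA y j))"

definition nowhere_dense_in :: "'a topology \<Rightarrow> 'a set \<Rightarrow> bool" where
  "nowhere_dense_in X N \<longleftrightarrow> N \<subseteq> topspace X \<and> X interior_of (X closure_of N) = {}"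

definition meager_in :: "'a topology \<Rightarrow> 'a set \<Rightarrow> bool" where
  "meager_in X M \<longleftrightarrow> M \<subseteq> topspace X \<and>
     (\<exists>N :: nat \<Rightarrow> 'a set. (\<forall>k. nowhere_dense_in X (N k)) \<and> M \<subseteq> (\<Union>k. N k))"

definition comeager_in :: "'a topology \<Rightarrow> 'a set \<Rightarrow> bool" where
  "comeager_in X C \<longleftrightarrow> C \<subseteq> topspace X \<and> meager_in X (topspace X - C)"

definition borel_sets_of :: "'a topology \<Rightarrow> 'a set set" where
  "borel_sets_of X = sigma_sets (topspace X) {U. openin X U}"

definition borel_map :: "'a topology \<Rightarrow> 'b topology \<Rightarrow> ('a \<Rightarrow> 'b) \<Rightarrow> bool" where
  "borel_map X Y f \<longleftrightarrow> f ` topspace X \<subseteq> topspace Y \<and>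
     (\<forall>U. openin Y U \<longrightarrow> {x \<in> topspace X. f x \<in> U} \<in> borel_sets_of X)"

definition borel_reducible ::
  "'a topology \<Rightarrow> ('a \<Rightarrow> 'a \<Rightarrow> bool) \<Rightarrow> 'b topology \<Rightarrow> ('b \<Rightarrow> 'b \<Rightarrow> bool) \<Rightarrow> bool" where
  "borel_reducible X E Y F \<longleftrightarrow> (\<exists>f. borel_map X Y f \<and>
     (\<forall>x\<in>topspace X. \<forall>y\<in>topspace X. E x y \<longleftrightarrow> F (f x) (f y)))"

end

theory Submission
  imports Defs
begin

text \<open>
  Every finite pattern of bits occurs in a point of \<open>Xset n\<close>, so a generic point is a sequence of
  generic reals (level 0) together with generic bipartite graphs between consecutive levels. Given
  \<open>x\<close>, such a structure is built invariantly from the sets coded by \<open>x\<close>: an element of level \<open>i\<close> is a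
  pair \<open>(F, c)\<close> of a finite list \<open>F\<close> of sets of level at most \<open>i\<close> and a code \<open>c\<close>. Whether two elements
  of consecutive levels are related depends only on their codes and on the equalities and memberships
  between their lists, and the codes are rich enough to realise every finite configuration. An
  element of level 0 is labelled by a point of a perfect set whose finite injective tuples are generic
  (Mycielski), with an initial segment prescribed by \<open>c\<close>. A greedy enumeration of this structure
  yields a point of \<open>C\<close>; taking least codes makes it Borel in \<open>x\<close>. Different elements have different
  neighbourhoods in the level below, so the hereditary sets coded by the new point determine, and are
  determined by, the sets of elements, hence those coded by \<open>x\<close>.
\<close>

section \<open>Mutually generic functions\<close>

definition agree_on :: "nat \<Rightarrow> nat \<Rightarrow> (nat \<Rightarrow> nat \<Rightarrow> 'b) \<Rightarrow> (nat \<Rightarrow> nat \<Rightarrow> 'b) \<Rightarrow> bool" where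
  "agree_on a m q q' \<longleftrightarrow> (\<forall>k<a. \<forall>b<m. q k b = q' k b)"

definition decides :: "nat \<Rightarrow> nat \<Rightarrow> (nat \<Rightarrow> nat \<Rightarrow> 'b) \<Rightarrow> ((nat \<Rightarrow> nat \<Rightarrow> 'b) \<Rightarrow> bool) \<Rightarrow> bool" where
  "decides a m q U \<longleftrightarrow> (\<forall>q'. agree_on a m q q' \<longrightarrow> U q')"

definition dense_requirement :: "nat \<Rightarrow> ((nat \<Rightarrow> nat \<Rightarrow> 'b) \<Rightarrow> bool) \<Rightarrow> bool" where
  "dense_requirement a U \<longleftrightarrow> (\<forall>q m. \<exists>q' m'. agree_on a m q q' \<and> decides a m' q' U)"

lemma decides_mono: "decides a m q U \<Longrightarrow> m \<le> m' \<Longrightarrow> agree_on a m q q' \<Longrightarrow> decides a m' q' U"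
  by (auto simp: decides_def agree_on_def)

lemma fusion_tuple:
  fixes S :: "'a \<Rightarrow> nat \<Rightarrow> 'b"
  assumes "distinct ss" and "dense_requirement (length ss) U"
  shows "\<exists>S' m'. m \<le> m' \<and> (\<forall>\<sigma>. \<forall>b<m. S' \<sigma> b = S \<sigma> b) \<and> decides (length ss) m' (\<lambda>k. S' (ss ! k)) U"
proof -
  obtain q m' where q: "agree_on (length ss) m (\<lambda>k. S (ss ! k)) q" "decides (length ss) m' q U"
    using assms(2) unfolding dense_requirement_def by blast
  define index where "index = the_inv_into {..<length ss} ((!) ss)"
  define S' where "S' \<sigma> = (if \<sigma> \<in> set ss then q (index \<sigma>) else S \<sigma>)" for \<sigma>
  have S'_nth: "S' (ss ! k) = q k" if "k < length ss" for k
    using that the_inv_into_f_f[OF inj_on_nth[OF assms(1)], of "{..<length ss}"]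
    by (simp add: S'_def index_def)
  have "S' \<sigma> b = S \<sigma> b" if "b < m" for \<sigma> b
  proof (cases "\<sigma> \<in> set ss")
    case True
    then obtain k where "k < length ss" "\<sigma> = ss ! k" by (auto simp: in_set_conv_nth)
    then show ?thesis using S'_nth q(1) that by (simp add: agree_on_def)
  qed (simp add: S'_def)
  moreover have "decides (length ss) (max m m') (\<lambda>k. S' (ss ! k)) U"
    by (rule decides_mono[OF q(2)]) (auto simp: agree_on_def S'_nth)
  ultimately show ?thesis by (intro exI[of _ S'] exI[of _ "max m m'"]) simp
qed

lemma fusion_finite:
  fixes S :: "'a \<Rightarrow> nat \<Rightarrow> 'b"
  assumes "finite K" and "\<And>ss U. (ss, U) \<in> K \<Longrightarrow> distinct ss \<and> dense_requirement (length ss) U"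
  shows "\<exists>S' m'. m \<le> m' \<and> (\<forall>\<sigma>. \<forall>b<m. S' \<sigma> b = S \<sigma> b) \<and>
    (\<forall>ss U. (ss, U) \<in> K \<longrightarrow> decides (length ss) m' (\<lambda>k. S' (ss ! k)) U)"
  using assms
proof (induction K rule: finite_induct)
  case empty
  show ?case by auto
next
  case (insert p K)
  obtain ss U where p: "p = (ss, U)" by (cases p)
  obtain S' m' where S': "m \<le> m'" "\<And>\<sigma> b. b < m \<Longrightarrow> S' \<sigma> b = S \<sigma> b"
    and old: "\<And>ss U. (ss, U) \<in> K \<Longrightarrow> decides (length ss) m' (\<lambda>k. S' (ss ! k)) U"
    using insert.IH insert.prems by (metis insertCI)
  obtain S'' m'' where S'': "m' \<le> m''" "\<And>\<sigma> b. b < m' \<Longrightarrow> S'' \<sigma> b = S' \<sigma> b"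
    and new: "decides (length ss) m'' (\<lambda>k. S'' (ss ! k)) U"
    using fusion_tuple[of ss U m' S'] insert.prems[of ss U] p by blast
  have "decides (length ss') m'' (\<lambda>k. S'' (ss' ! k)) U'" if "(ss', U') \<in> K" for ss' U'
    using decides_mono[OF old[OF that] S''(1)] S''(2) by (simp add: agree_on_def)
  then have "\<forall>ss' U'. (ss', U') \<in> insert p K \<longrightarrow> decides (length ss') m'' (\<lambda>k. S'' (ss' ! k)) U'"
    using new p by simp
  moreover have "\<forall>\<sigma>. \<forall>b<m. S'' \<sigma> b = S \<sigma> b"
    using S' S'' by simp
  moreover have "m \<le> m''"
    using S'(1) S''(1) by simp
  ultimately show ?case
    by (intro exI[of _ S''] exI[of _ m''] conjI)
qed

definition decides_level ::
  "nat \<Rightarrow> nat \<Rightarrow> ('a list \<Rightarrow> nat \<Rightarrow> 'b) \<Rightarrow> nat \<Rightarrow> ((nat \<Rightarrow> nat \<Rightarrow> 'b) \<Rightarrow> bool) \<Rightarrow> bool" where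
  "decides_level t m S a U \<longleftrightarrow>
     (\<forall>ss. distinct ss \<longrightarrow> length ss = a \<longrightarrow> (\<forall>\<sigma>\<in>set ss. length \<sigma> = t) \<longrightarrow> decides a m (\<lambda>k. S (ss ! k)) U)"

lemma fusion_level:
  fixes S :: "'a::finite list \<Rightarrow> nat \<Rightarrow> 'b"
  assumes "finite K" and dense: "\<And>a U. (a, U) \<in> K \<Longrightarrow> dense_requirement a U"
  shows "\<exists>S' m'. m \<le> m' \<and> (\<forall>\<sigma>. \<forall>b<m. S' \<sigma> b = S \<sigma> b) \<and> (\<forall>a U. (a, U) \<in> K \<longrightarrow> decides_level t m' S' a U)"
proof -
  define nodes where "nodes = {\<sigma> :: 'a list. length \<sigma> = t}"
  define tasks where "tasks = {(ss, U). (length ss, U) \<in> K \<and> distinct ss \<and> set ss \<subseteq> nodes}"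
  have "finite nodes"
    using finite_lists_length_eq[of "UNIV :: 'a set" t] by (simp add: nodes_def)
  then have "finite (\<Union>(a, U)\<in>K. {ss. set ss \<subseteq> nodes \<and> length ss = a} \<times> {U})"
    using assms(1) finite_lists_length_eq by (intro finite_UN_I) auto
  then have "finite tasks" by (rule finite_subset[rotated]) (auto simp: tasks_def)
  moreover have "distinct ss \<and> dense_requirement (length ss) U" if "(ss, U) \<in> tasks" for ss U
    using that dense by (simp add: tasks_def)
  ultimately obtain S' m' where S': "m \<le> m'" "\<forall>\<sigma>. \<forall>b<m. S' \<sigma> b = S \<sigma> b"
    and decided: "\<And>ss U. (ss, U) \<in> tasks \<Longrightarrow> decides (length ss) m' (\<lambda>k. S' (ss ! k)) U"
    using fusion_finite[of tasks m S] by blast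
  have "decides_level t m' S' a U" if "(a, U) \<in> K" for a U
    using that decided by (auto simp: decides_level_def tasks_def nodes_def)
  then show ?thesis using S' by blast
qed

lemma fusion_tree:
  fixes R :: "(nat \<times> ((nat \<Rightarrow> nat \<Rightarrow> 'b) \<Rightarrow> bool)) set"
  assumes "countable R" and dense: "\<And>a U. (a, U) \<in> R \<Longrightarrow> dense_requirement a U"
  obtains m and S :: "nat \<Rightarrow> 'a::finite list \<Rightarrow> nat \<Rightarrow> 'b" where "strict_mono m"
    and "\<And>t \<sigma> b. b < m t \<Longrightarrow> S (Suc t) \<sigma> b = S t (take t \<sigma>) b"
    and "\<And>a U. (a, U) \<in> R \<Longrightarrow> \<forall>\<^sub>F t in sequentially. decides_level t (m t) (S t) a U"
proof -
  define due where "due t = {r \<in> R. to_nat_on R r \<le> t}" for t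
  define fuses where "fuses t p p' \<longleftrightarrow> fst p < fst p' \<and>
      (\<forall>\<sigma>. \<forall>b<fst p. snd p' \<sigma> b = snd p (take t \<sigma>) b) \<and>
      (\<forall>a U. (a, U) \<in> due t \<longrightarrow> decides_level (Suc t) (fst p') (snd p') a U)"
    for t and p p' :: "nat \<times> ('a list \<Rightarrow> nat \<Rightarrow> 'b)"
  have finite_due: "finite (due t)" for t
    by (rule inj_on_finite[of "to_nat_on R" _ "{..t}"])
      (auto simp: due_def intro: inj_on_subset[OF inj_on_to_nat_on[OF assms(1)]])
  have "\<exists>p'. fuses t p p'" for t p
  proof -
    have "dense_requirement a U" if "(a, U) \<in> due t" for a U
      using that dense by (simp add: due_def)
    from fusion_level[OF finite_due this, where m = "Suc (fst p)" and S = "\<lambda>\<sigma>. snd p (take t \<sigma>)"]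
    obtain S' m' where "Suc (fst p) \<le> m'" "\<forall>\<sigma>. \<forall>b<Suc (fst p). S' \<sigma> b = snd p (take t \<sigma>) b"
      "\<forall>a U. (a, U) \<in> due t \<longrightarrow> decides_level (Suc t) m' S' a U"
      by blast
    then have "fuses t p (m', S')" by (simp add: fuses_def)
    then show ?thesis by blast
  qed
  then obtain f where f: "\<And>t. fuses t (f t) (f (Suc t))"
    using dependent_nat_choice[of "\<lambda>_ _. True" fuses] by auto
  have "decides_level (Suc t) (fst (f (Suc t))) (snd (f (Suc t))) a U"
    if "(a, U) \<in> R" "to_nat_on R (a, U) \<le> t" for a U t
    using f[of t] that by (auto simp: fuses_def due_def)
  then have "\<forall>\<^sub>F t in sequentially. decides_level t (fst (f t)) (snd (f t)) a U" if "(a, U) \<in> R" for a U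
    using that by (subst eventually_sequentially_Suc[symmetric]) (auto simp: eventually_sequentially)
  then show ?thesis
    using f by (intro that[of "fst \<circ> f" "snd \<circ> f"]) (auto simp: fuses_def strict_mono_Suc_iff)
qed

lemma fusion_limit_eq:
  fixes S :: "nat \<Rightarrow> 'a list \<Rightarrow> nat \<Rightarrow> 'b"
  assumes "strict_mono m" and S_Suc: "\<And>t \<sigma> b. b < m t \<Longrightarrow> S (Suc t) \<sigma> b = S t (take t \<sigma>) b"
    and "b < m t"
  shows "S (Suc b) (map z [0..<Suc b]) b = S t (map z [0..<t]) b"
proof -
  have stable: "S u (map z [0..<u]) b = S t (map z [0..<t]) b" if "t \<le> u" "b < m t" for t u
    using that(1)
  proof (induction u rule: dec_induct)
    case (step u)
    have "b < m u" using that(2) step.hyps(1) assms(1) by (meson less_le_trans strict_mono_less_eq)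
    then show ?case using step.IH S_Suc[of b u "map z [0..<Suc u]"] by (simp add: take_map)
  qed simp
  have "b < m (Suc b)" using strict_mono_imp_increasing[OF assms(1), of "Suc b"] by simp
  then show ?thesis
    using stable[of "Suc b" t] stable[of t "Suc b"] assms(3) by (cases "Suc b \<le> t") simp_all
qed

lemma eventually_inj_on_prefix:
  fixes z :: "'k \<Rightarrow> nat \<Rightarrow> 'a"
  assumes "finite A" and "inj_on z A"
  shows "\<forall>\<^sub>F t in sequentially. inj_on (\<lambda>k. map (z k) [0..<t]) A"
proof -
  have "\<forall>\<^sub>F t in sequentially. map (z k) [0..<t] = map (z l) [0..<t] \<longrightarrow> k = l" if "k \<in> A" "l \<in> A" for k l
  proof (cases "k = l")
    case False
    then have "z k \<noteq> z l" using assms(2) that by (auto dest: inj_onD)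
    then obtain b where "z k b \<noteq> z l b" by blast
    then show ?thesis by (intro eventually_mono[OF eventually_gt_at_top[of b]]) auto
  qed simp
  then have "\<forall>\<^sub>F t in sequentially. \<forall>k\<in>A. \<forall>l\<in>A. map (z k) [0..<t] = map (z l) [0..<t] \<longrightarrow> k = l"
    using assms(1) by (intro eventually_ball_finite ballI)
  then show ?thesis by (simp add: inj_on_def)
qed

lemma open_prefix_nbhd:
  fixes z :: "nat \<Rightarrow> 'a::discrete_topology"
  shows "open {z'. \<forall>c<n. z' c = z c}"
  using product_topology_basis'[of "{..<n}" "\<lambda>c. {z c}" "\<lambda>c. c"]
  by (simp add: open_discrete Ball_def)

lemma continuous_on_prefix_determined:
  fixes f :: "(nat \<Rightarrow> 'a::discrete_topology) \<Rightarrow> 'b::topological_space"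
  assumes "\<And>z z'. (\<And>c. c < n \<Longrightarrow> z' c = z c) \<Longrightarrow> f z' = f z"
  shows "continuous_on UNIV f"
proof -
  have "z' \<in> f -` B" if "z \<in> f -` B" "\<forall>c<n. z' c = z c" for z z' B
    using assms[of z' z] that by simp
  then have "f -` B = (\<Union>z\<in>f -` B. {z'. \<forall>c<n. z' c = z c})" for B
    by blast
  moreover have "open (\<Union>z\<in>f -` B. {z'. \<forall>c<n. z' c = z c})" for B
    by (intro open_UN ballI open_prefix_nbhd)
  ultimately have "open (f -` B)" for B
    by simp
  then show ?thesis by (simp add: continuous_on_open_vimage)
qed

text \<open>Fusion along a tree: at stage \<open>t\<close> all tuples of distinct nodes of length \<open>t\<close> are pushed into
  the finitely many requirements considered so far.\<close>
theorem mycielski: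
  fixes R :: "(nat \<times> ((nat \<Rightarrow> nat \<Rightarrow> 'b::topological_space) \<Rightarrow> bool)) set"
  assumes "countable R" and "\<And>a U. (a, U) \<in> R \<Longrightarrow> dense_requirement a U"
  shows "\<exists>\<phi> :: (nat \<Rightarrow> 'a::{finite, discrete_topology}) \<Rightarrow> nat \<Rightarrow> 'b. continuous_on UNIV \<phi> \<and>
    (\<forall>a U z. (a, U) \<in> R \<longrightarrow> inj_on z {..<a} \<longrightarrow> U (\<lambda>k. \<phi> (z k)))"
proof -
  obtain m and S :: "nat \<Rightarrow> 'a list \<Rightarrow> nat \<Rightarrow> 'b" where m: "strict_mono m"
    and S_Suc: "\<And>t \<sigma> b. b < m t \<Longrightarrow> S (Suc t) \<sigma> b = S t (take t \<sigma>) b"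
    and decided: "\<And>a U. (a, U) \<in> R \<Longrightarrow> \<forall>\<^sub>F t in sequentially. decides_level t (m t) (S t) a U"
    using fusion_tree[OF assms, where 'a = 'a] by blast
  define \<phi> where "\<phi> z b = S (Suc b) (map z [0..<Suc b]) b" for z b
  have \<phi>_eq: "\<phi> z b = S t (map z [0..<t]) b" if "b < m t" for z b t
    unfolding \<phi>_def using m S_Suc that by (rule fusion_limit_eq)
  have "continuous_on UNIV \<phi>"
  proof (rule continuous_on_coordinatewise_then_product)
    fix b
    show "continuous_on UNIV (\<lambda>z. \<phi> z b)"
    proof (rule continuous_on_prefix_determined)
      fix z z' :: "nat \<Rightarrow> 'a"
      assume "\<And>c. c < Suc b \<Longrightarrow> z' c = z c"
      then have "map z' [0..<Suc b] = map z [0..<Suc b]" by (simp del: upt_Suc)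
      then show "\<phi> z' b = \<phi> z b" by (simp only: \<phi>_def)
    qed
  qed
  moreover have "U (\<lambda>k. \<phi> (z k))" if "(a, U) \<in> R" and inj: "inj_on z {..<a}" for a U z
  proof -
    have "\<forall>\<^sub>F t in sequentially. inj_on (\<lambda>k. map (z k) [0..<t]) {..<a}"
      using inj by (intro eventually_inj_on_prefix) auto
    from eventually_happens'[OF sequentially_bot eventually_conj[OF this decided[OF that(1)]]]
    obtain t where "inj_on (\<lambda>k. map (z k) [0..<t]) {..<a}" "decides_level t (m t) (S t) a U"
      by blast
    then have "decides a (m t) (\<lambda>k. S t (map (\<lambda>k. map (z k) [0..<t]) [0..<a] ! k)) U"
      unfolding decides_level_def by (simp add: distinct_map atLeast0LessThan)
    then show ?thesis by (simp add: decides_def agree_on_def \<phi>_eq)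
  qed
  ultimately show ?thesis by blast
qed

section \<open>The spaces \<open>Xset n\<close>\<close>

instance bool :: second_countable_topology
proof
  show "\<exists>B :: bool set set. countable B \<and> open = generate_topology B"
    by (intro exI[of _ UNIV]) (auto simp: open_discrete fun_eq_iff intro: generate_topology.Basis)
qed

lemma product_topology_euclidean_eq_top_of_set:
  "product_topology (\<lambda>_. euclidean :: 'b::topological_space topology) I = top_of_set (Pi\<^sub>E I (\<lambda>_. UNIV))"
  (is "?P = ?S")
proof -
  have "continuous_map ?P (product_topology (\<lambda>_. euclidean) UNIV) id"
    unfolding continuous_map_componentwise_UNIV
  proof
    fix i
    show "continuous_map ?P euclidean (\<lambda>x. id x i)"
    proof (cases "i \<in> I")
      case False
      then show ?thesis
        by (intro continuous_map_eq[OF continuous_map_const[THEN iffD2], of _ undefined])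
          (auto simp: PiE_def extensional_def)
    qed (simp add: continuous_map_product_projection[of i I "\<lambda>_. euclidean"])
  qed
  then have P_S: "continuous_map ?P ?S id"
    by (auto simp: continuous_map_in_subtopology euclidean_product_topology)
  have S_P: "continuous_map ?S ?P id"
    unfolding continuous_map_componentwise
    by (auto simp: PiE_def intro: continuous_on_product_then_coordinatewise[OF continuous_on_id])
  have "openin Y U" if "continuous_map Y Z id" "openin Z U" "topspace Y = topspace Z"
    for Y Z :: "('a \<Rightarrow> 'b) topology" and U
    using openin_continuous_map_preimage[OF that(1,2)] openin_subset[OF that(2)] that(3)
    by (simp add: Int_absorb1 flip: Int_def)
  from this[OF P_S] this[OF S_P] show ?thesis
    by (auto simp: topology_eq)
qed

lemma cantor_top_eq: "cantor_top = euclidean"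
proof -
  have "discrete_topology UNIV = (euclidean :: bool topology)"
    by (simp add: discrete_topology_unique open_discrete)
  then show ?thesis by (simp add: cantor_top_def euclidean_product_topology)
qed

lemma ambient_top_eq: "ambient_top n = top_of_set {y. \<forall>i. \<not> enat i < n \<longrightarrow> y i = undefined}"
proof -
  have "ambient_top n = top_of_set (Pi\<^sub>E {i. enat i < n} (\<lambda>_. UNIV))"
    by (simp add: ambient_top_def seq_top_def cantor_top_eq euclidean_product_topology
        product_topology_euclidean_eq_top_of_set)
  also have "Pi\<^sub>E {i. enat i < n} (\<lambda>_. UNIV) = {y. \<forall>i. \<not> enat i < n \<longrightarrow> y i = undefined}"
    by (auto simp: PiE_def extensional_def)
  finally show ?thesis .
qed

lemma enat_le_less_trans: "j \<le> i \<Longrightarrow> enat i < n \<Longrightarrow> enat j < n"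
  by (meson enat_ord_simps(1) le_less_trans)

lemma Xset_iff:
  "x \<in> Xset n \<longleftrightarrow> (\<forall>i. \<not> enat i < n \<longrightarrow> x i = undefined) \<and>
    (\<forall>i. enat (Suc i) < n \<longrightarrow> (\<forall>m. \<exists>k. x (Suc i) k m) \<and> (\<forall>k. \<exists>m. x (Suc i) k m) \<and>
      (\<forall>k l l'. x i l = x i l' \<longrightarrow> x (Suc i) k l = x (Suc i) k l'))"
proof -
  have shift: "(\<forall>i. 1 \<le> i \<and> enat i < n \<longrightarrow> P i) \<longleftrightarrow> (\<forall>i. enat (Suc i) < n \<longrightarrow> P (Suc i))" for P
  proof -
    have "P i" if "\<forall>i. enat (Suc i) < n \<longrightarrow> P (Suc i)" "1 \<le> i \<and> enat i < n" for i
      using that by (cases i) auto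
    then show ?thesis by auto
  qed
  show ?thesis unfolding Xset_def ambient_top_eq shift by simp
qed

lemma Xtop_eq: "Xtop n = top_of_set (Xset n)"
proof -
  have "Xset n \<subseteq> {y. \<forall>i. \<not> enat i < n \<longrightarrow> y i = undefined}"
    by (auto simp: Xset_iff)
  then show ?thesis
    by (simp add: Xtop_def ambient_top_eq subtopology_subtopology Int_absorb1)
qed

definition cylinder :: "enat \<Rightarrow> nat \<Rightarrow> pt \<Rightarrow> pt set" where
  "cylinder n L y = {y'. \<forall>i<L. enat i < n \<longrightarrow> (\<forall>k<L. \<forall>m<L. y' i k m = y i k m)}"

lemma mem_cylinder_self: "y \<in> cylinder n L y"
  by (simp add: cylinder_def)

lemma cylinder_eq: "y' \<in> cylinder n L y \<Longrightarrow> cylinder n L y' = cylinder n L y"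
  by (auto simp: cylinder_def)

lemma cylinder_antimono: "L \<le> L' \<Longrightarrow> cylinder n L' y \<subseteq> cylinder n L y"
  by (auto simp: cylinder_def)

lemma cylinder_infinity_subset: "cylinder \<infinity> L y \<subseteq> cylinder n L y"
  by (auto simp: cylinder_def)

lemma continuous_on_pt_bit: "continuous_on UNIV (\<lambda>y :: pt. y i k m)"
  using continuous_on_product_coordinates[THEN continuous_on_product_then_coordinatewise,
      THEN continuous_on_product_then_coordinatewise] .

lemma open_cylinder: "open (cylinder n L y)"
proof -
  have "open {y' :: pt. y' i k m = y i k m}" for i k m
    using open_vimage[OF open_discrete continuous_on_pt_bit[of i k m], of "{y i k m}"]
    by (simp add: vimage_def)
  then have "open (\<Inter>i\<in>{i. i < L \<and> enat i < n}. \<Inter>k<L. \<Inter>m<L. {y' :: pt. y' i k m = y i k m})"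
    by (intro open_INT ballI) auto
  moreover have "cylinder n L y = (\<Inter>i\<in>{i. i < L \<and> enat i < n}. \<Inter>k<L. \<Inter>m<L. {y'. y' i k m = y i k m})"
    by (auto simp: cylinder_def)
  ultimately show ?thesis by simp
qed

lemma tendsto_fun_iff:
  fixes f :: "'a \<Rightarrow> 'i \<Rightarrow> 'b::topological_space"
  shows "(f \<longlongrightarrow> l) F \<longleftrightarrow> (\<forall>i. ((\<lambda>a. f a i) \<longlongrightarrow> l i) F)"
proof -
  have "(f \<longlongrightarrow> l) F \<longleftrightarrow> limitin (product_topology (\<lambda>_. euclidean) UNIV) f l F"
    by (simp only: euclidean_product_topology limitin_canonical_iff)
  then show ?thesis by (simp add: limitin_componentwise)
qed

lemma open_contains_cylinder:
  assumes "open V" and "y \<in> V"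
  shows "\<exists>L. cylinder \<infinity> L y \<subseteq> V"
proof (rule ccontr)
  assume "\<not> ?thesis"
  then have "\<forall>L. \<exists>z. z \<in> cylinder \<infinity> L y \<and> z \<notin> V"
    by blast
  then obtain z where z: "\<And>L. z L \<in> cylinder \<infinity> L y" "\<And>L. z L \<notin> V"
    by metis
  have "\<forall>\<^sub>F L in sequentially. z L i k m = y i k m" for i k m
    using z(1)
    by (intro eventually_mono[OF eventually_gt_at_top[of "i + k + m"]]) (auto simp: cylinder_def)
  then have "z \<longlonglongrightarrow> y"
    by (simp add: tendsto_fun_iff tendsto_discrete)
  then show False
    using topological_tendstoD[OF _ assms] z(2) by fastforce
qed

text \<open>Outside the prescribed block the rows are made pairwise different, so that the third condition
  on \<open>Xset n\<close> becomes vacuous.\<close>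
lemma Xset_meets_cylinder: "Xset n \<inter> cylinder n L y \<noteq> {}"
proof -
  define y' where "y' = restrict
    (\<lambda>i k m. if k < L \<and> m < L then y i k m else m = k + L \<or> k = m + L) {i. enat i < n}"
  have y'_bit: "y' i k m = (if k < L \<and> m < L then y i k m else m = k + L \<or> k = m + L)"
    if "enat i < n" for i k m
    using that by (simp add: y'_def)
  have row_inj: "k = l" if "y' i k = y' i l" "enat i < n" for i k l
  proof -
    have "y' i l (k + L)" "y' i k (l + L)"
      using that y'_bit[of i k "k + L"] y'_bit[of i l "l + L"] by simp_all
    then show ?thesis using that(2) by (auto simp: y'_bit split: if_splits)
  qed
  have "y' (Suc i) (m + L) m" "y' (Suc i) k (k + L)" if "enat (Suc i) < n" for i k m
    using that by (simp_all add: y'_bit)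
  moreover have "y' (Suc i) k l = y' (Suc i) k l'" if "enat (Suc i) < n" "y' i l = y' i l'" for i k l l'
    using row_inj[OF that(2)] enat_le_less_trans[OF _ that(1), of i] by simp
  moreover have "y' i = undefined" if "\<not> enat i < n" for i
    using that by (simp add: y'_def)
  ultimately have "y' \<in> Xset n" unfolding Xset_iff by blast
  moreover have "y' \<in> cylinder n L y" by (simp add: cylinder_def y'_bit)
  ultimately show ?thesis by blast
qed

definition forces :: "enat \<Rightarrow> nat \<Rightarrow> pt \<Rightarrow> pt set \<Rightarrow> bool" where
  "forces n L y D \<longleftrightarrow> Xset n \<inter> cylinder n L y \<subseteq> D"

lemma forces_mono: "forces n L y D \<Longrightarrow> L \<le> L' \<Longrightarrow> forces n L' y D"
  using cylinder_antimono[of L L' n y] by (auto simp: forces_def)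

lemma forces_cong: "y' \<in> cylinder n L y \<Longrightarrow> forces n L y D \<longleftrightarrow> forces n L y' D"
  by (simp add: forces_def cylinder_eq)

lemma forces_imp_mem: "forces n L y D \<Longrightarrow> y \<in> Xset n \<Longrightarrow> y \<in> D"
  using mem_cylinder_self by (auto simp: forces_def)

lemma open_forces: "open {y. forces n L y D}"
proof -
  have "{y. forces n L y D} = (\<Union>y\<in>{y. forces n L y D}. cylinder n L y)"
    using mem_cylinder_self forces_cong by blast
  moreover have "open (\<Union>y\<in>{y. forces n L y D}. cylinder n L y)"
    by (intro open_UN ballI open_cylinder)
  ultimately show ?thesis by simp
qed

lemma dense_open_forces_ex:
  assumes "openin (Xtop n) D" and "Xtop n closure_of D = topspace (Xtop n)"
  shows "\<exists>L'\<ge>L. \<exists>y'\<in>cylinder \<infinity> L y. forces n L' y' D"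
proof -
  have "openin (Xtop n) (Xset n \<inter> cylinder n L y)"
    unfolding Xtop_eq using open_cylinder by (rule openin_open_Int)
  then obtain x where x: "x \<in> Xset n" "x \<in> cylinder n L y" "x \<in> D"
    using assms(2) Xset_meets_cylinder[of n L y] unfolding dense_intersects_open by blast
  obtain V where V: "open V" "D = Xset n \<inter> V"
    using assms(1) by (auto simp: Xtop_eq openin_open)
  then obtain M where M: "cylinder \<infinity> M x \<subseteq> V"
    using open_contains_cylinder x(3) by blast
  have "Xset n \<inter> cylinder n M x \<subseteq> cylinder \<infinity> M x"
    using x(1) by (auto simp: cylinder_def Xset_iff)
  then have "forces n M x D"
    using M V(2) by (auto simp: forces_def)
  then have "forces n (max L M) x D"
    by (rule forces_mono) simp
  moreover define y' where "y' i = (if enat i < n then x i else y i)" for i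
  have "y' \<in> cylinder n (max L M) x" by (simp add: cylinder_def y'_def)
  ultimately have "forces n (max L M) y' D" using forces_cong by simp
  moreover have "y' \<in> cylinder \<infinity> L y" using x(2) by (simp add: cylinder_def y'_def)
  ultimately show ?thesis by (intro exI[of _ "max L M"]) auto
qed

lemma comeager_in_contains_Inter_dense_open:
  assumes "comeager_in X C"
  shows "\<exists>D :: nat \<Rightarrow> 'a set. (\<forall>t. openin X (D t) \<and> X closure_of (D t) = topspace X) \<and> (\<Inter>t. D t) \<subseteq> C"
proof -
  obtain N :: "nat \<Rightarrow> 'a set" where N: "\<And>t. nowhere_dense_in X (N t)" "topspace X - C \<subseteq> (\<Union>t. N t)"
    using assms by (auto simp: comeager_in_def meager_in_def)
  define D where "D t = topspace X - X closure_of (N t)" for t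
  have "openin X (D t)" "X closure_of (D t) = topspace X" for t
    using N(1)[of t] by (auto simp: D_def closure_of_complement nowhere_dense_in_def)
  moreover have "y \<in> C" if "y \<in> (\<Inter>t. D t)" for y
  proof (rule ccontr)
    assume "y \<notin> C"
    moreover have "y \<in> topspace X" using that by (simp add: D_def)
    ultimately obtain t where "y \<in> N t" using N(2) by blast
    moreover have "y \<notin> X closure_of N t" using that by (simp add: D_def)
    ultimately show False
      using closure_of_subset[of "N t" X] N(1)[of t] by (auto simp: nowhere_dense_in_def)
  qed
  ultimately show ?thesis by blast
qed

lemma borel_sets_of_top_of_set: "borel_sets_of (top_of_set S) = sets (restrict_space borel S)"
proof -
  have "{U. openin (top_of_set S) U} = {id -` V \<inter> S | V. V \<in> {V. open V}}"
    by (auto simp: openin_open)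
  then have "borel_sets_of (top_of_set S) = {id -` A \<inter> S | A. A \<in> sets borel}"
    using sigma_sets_vimage_commute[of id S UNIV "{V. open V}"]
    by (simp add: borel_sets_of_def sets_borel)
  then show ?thesis
    by (auto simp: sets_restrict_space)
qed

lemma borel_map_top_of_set:
  assumes "f \<in> borel_measurable borel" and "f ` S \<subseteq> T"
  shows "borel_map (top_of_set S) (top_of_set T) f"
  unfolding borel_map_def
proof (intro conjI allI impI)
  fix U assume "openin (top_of_set T) U"
  then obtain V where V: "open V" "U = T \<inter> V" by (auto simp: openin_open)
  then have "{x \<in> topspace (top_of_set S). f x \<in> U} = S \<inter> f -` V" using assms(2) by auto
  moreover have "f -` V \<in> sets borel" using measurable_sets[OF assms(1) borel_open[OF V(1)]] by simp
  ultimately show "{x \<in> topspace (top_of_set S). f x \<in> U} \<in> borel_sets_of (top_of_set S)"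
    by (auto simp: borel_sets_of_top_of_set sets_restrict_space)
qed (use assms(2) in simp)

section \<open>Elements and their relations\<close>

fun hmem :: "hs \<Rightarrow> hs \<Rightarrow> bool" where
  "hmem h (Atom z) = False"
| "hmem h (HSet S) = (h \<in> rcset S)"

definition next_level :: "hs set \<Rightarrow> hs set" where
  "next_level S = S \<union> {HSet T | T. rcset T \<subseteq> S}"

lemma subset_next_level: "S \<subseteq> next_level S"
  by (auto simp: next_level_def)

definition trace :: "hs \<Rightarrow> hs list \<Rightarrow> (bool \<times> bool) list" where
  "trace f G = map (\<lambda>g. (f = g, hmem f g)) G"

type_synonym pattern = "(bool \<times> bool) list list"

definition cross_pattern :: "hs list \<Rightarrow> hs list \<Rightarrow> pattern" where
  "cross_pattern F G = map (\<lambda>f. trace f G) F"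

lemma next_level_separated:
  assumes "f \<in> next_level S" "g \<in> next_level S" "f \<noteq> g"
  shows "\<exists>e\<in>S. (e = f, hmem e f) \<noteq> (e = g, hmem e g)"
proof (cases "f \<in> S \<or> g \<in> S")
  case True
  then show ?thesis using assms(3) by auto
next
  case False
  then obtain T T' where T: "f = HSet T" "g = HSet T'" "rcset T \<subseteq> S" "rcset T' \<subseteq> S"
    using assms by (auto simp: next_level_def)
  then have "rcset T \<noteq> rcset T'" using assms(3) by (auto simp: rcset_inject)
  then obtain e where "e \<in> rcset T \<longleftrightarrow> e \<notin> rcset T'" by blast
  then show ?thesis using T by (intro bexI[of _ e]) auto
qed

lemma trace_separates:
  assumes "G \<noteq> G'" and "set G \<union> set G' \<subseteq> next_level S" and "S \<noteq> {}"
  shows "\<exists>e\<in>S. trace e G \<noteq> trace e G'"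
proof (cases "length G = length G'")
  case True
  then obtain j where j: "j < length G" "G ! j \<noteq> G' ! j" using assms(1) nth_equalityI by blast
  have "G ! j \<in> next_level S" "G' ! j \<in> next_level S"
    using assms(2) True j(1) nth_mem[of j G] nth_mem[of j G'] by auto
  then obtain e where e: "e \<in> S" "(e = G ! j, hmem e (G ! j)) \<noteq> (e = G' ! j, hmem e (G' ! j))"
    using next_level_separated j(2) by blast
  then have "trace e G ! j \<noteq> trace e G' ! j"
    using j True by (simp add: trace_def)
  then show ?thesis using e(1) by metis
next
  case False
  then show ?thesis using assms(3) by (metis ex_in_conv length_map trace_def)
qed

lemma inj_on_cross_pattern_witnesses_ex:
  assumes "finite \<G>" and "\<Union> (set ` \<G>) \<subseteq> next_level S" and "S \<noteq> {}"
  shows "\<exists>E\<subseteq>S. finite E \<and> (\<forall>F. E \<subseteq> set F \<longrightarrow> inj_on (cross_pattern F) \<G>)"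
proof -
  define pairs where "pairs = {(G, G'). G \<in> \<G> \<and> G' \<in> \<G> \<and> G \<noteq> G'}"
  have "\<exists>e. e \<in> S \<and> trace e (fst p) \<noteq> trace e (snd p)" if "p \<in> pairs" for p
    using trace_separates[of "fst p" "snd p" S] assms(2,3) that by (fastforce simp: pairs_def)
  then obtain e where e: "\<And>p. p \<in> pairs \<Longrightarrow> e p \<in> S \<and> trace (e p) (fst p) \<noteq> trace (e p) (snd p)"
    by metis
  have "pairs \<subseteq> \<G> \<times> \<G>" by (auto simp: pairs_def)
  then have "finite pairs" using assms(1) finite_subset by blast
  moreover have "inj_on (cross_pattern F) \<G>" if "e ` pairs \<subseteq> set F" for F
  proof (rule inj_onI, rule ccontr)
    fix G G' assume G: "G \<in> \<G>" "G' \<in> \<G>" "cross_pattern F G = cross_pattern F G'" "G \<noteq> G'"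
    then have "(G, G') \<in> pairs" by (simp add: pairs_def)
    then show False using e[of "(G, G')"] G(3) that by (auto simp: cross_pattern_def)
  qed
  ultimately show ?thesis using e by (intro exI[of _ "e ` pairs"]) auto
qed

lemma cross_pattern_left_inject:
  assumes "set G \<subseteq> set F" and "cross_pattern G F = cross_pattern G' F"
  shows "G = G'"
proof (rule nth_equalityI)
  show len: "length G = length G'"
    using arg_cong[OF assms(2), of length] by (simp add: cross_pattern_def)
  fix j assume j: "j < length G"
  then obtain r where r: "r < length F" "F ! r = G ! j"
    using assms(1) by (metis in_set_conv_nth nth_mem subsetD)
  have "cross_pattern G F ! j ! r = cross_pattern G' F ! j ! r" using assms(2) by simp
  then show "G ! j = G' ! j" using j r len by (simp add: cross_pattern_def trace_def)
qed

datatype 'a elem = Elem (support: "'a list") (code: nat)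

instance elem :: (countable) countable
  by countable_datatype

definition elems :: "'a set \<Rightarrow> 'a elem set" where
  "elems S = {v. set (support v) \<subseteq> S}"

lemma elems_mono: "S \<subseteq> T \<Longrightarrow> elems S \<subseteq> elems T"
  by (auto simp: elems_def)

lemma elems_eq_iff: "elems S = elems T \<longleftrightarrow> S = T"
proof -
  have "Elem [f] 0 \<in> elems S \<longleftrightarrow> f \<in> S" for f and S :: "'a set" by (simp add: elems_def)
  then show ?thesis by blast
qed

lemma elems_image: "elems (f ` S) = map_elem f ` elems S"
proof (intro equalityI subsetI)
  fix v assume "v \<in> elems (f ` S)"
  then have "support v \<in> lists (f ` S)" by (auto simp: elems_def)
  then obtain F where "set F \<subseteq> S" "support v = map f F"
    unfolding lists_image by auto
  then have "v = map_elem f (Elem F (code v))" "Elem F (code v) \<in> elems S"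
    by (simp_all add: elems_def elem.expand)
  then show "v \<in> map_elem f ` elems S" by blast
qed (auto simp: elems_def elem.map_sel subset_iff)

lemma countable_elems:
  assumes "countable S"
  shows "countable (elems S)"
proof -
  have "v \<in> case_prod Elem ` (lists S \<times> UNIV)" if "v \<in> elems S" for v
    using that by (intro image_eqI[of _ _ "(support v, code v)"]) (auto simp: elems_def)
  then have "elems S \<subseteq> case_prod Elem ` (lists S \<times> UNIV)" by blast
  then show ?thesis by (rule countable_subset) (simp add: assms)
qed

text \<open>The last component is padding: it makes room for arbitrarily large codes with given
  specifications.\<close>
definition code_data :: "nat \<Rightarrow> (nat \<times> pattern) list \<times> (nat \<times> pattern) list \<times> bool list \<times> nat" where
  "code_data = from_nat"

definition upper_spec :: "nat \<Rightarrow> (nat \<times> pattern) set" where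
  "upper_spec c = set (fst (code_data c))"

definition lower_spec :: "nat \<Rightarrow> (nat \<times> pattern) set" where
  "lower_spec c = set (fst (snd (code_data c)))"

definition stem :: "nat \<Rightarrow> bool list" where
  "stem c = fst (snd (snd (code_data c)))"

lemma code_with_specs_ex:
  assumes "finite P" and "finite Q"
  shows "\<exists>c>N. upper_spec c = P \<and> lower_spec c = Q \<and> stem c = w"
proof -
  obtain ps qs where "set ps = P" "set qs = Q" using assms finite_list by metis
  have "inj (\<lambda>j::nat. to_nat (ps, qs, w, j))" by (auto intro!: injI)
  then obtain c where "c \<in> range (\<lambda>j::nat. to_nat (ps, qs, w, j))" "N < c"
    using range_inj_infinite infinite_nat_iff_unbounded by metis
  then show ?thesis
    using \<open>set ps = P\<close> \<open>set qs = Q\<close> by (auto simp: upper_spec_def lower_spec_def stem_def code_data_def)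
qed

text \<open>The larger code decides, so that a new element can prescribe its relations to all elements
  chosen before it.\<close>
definition related_codes :: "nat \<Rightarrow> nat \<Rightarrow> pattern \<Rightarrow> bool" where
  "related_codes c d p \<longleftrightarrow> (if d < c then (d, p) \<in> upper_spec c else (c, p) \<in> lower_spec d)"

definition related :: "hs elem \<Rightarrow> hs elem \<Rightarrow> bool" where
  "related u v = related_codes (code u) (code v) (cross_pattern (support u) (support v))"

lemma code_with_relations_ex:
  assumes "finite \<A>" and "finite \<L>"
    and inj_above: "inj_on (\<lambda>a. (code a, cross_pattern F (support a))) \<A>"
    and inj_below: "inj_on (\<lambda>b. (code b, cross_pattern (support b) F)) \<L>"
  shows "\<exists>c>N. stem c = w \<and> (\<forall>a\<in>\<A>. related (Elem F c) a \<longleftrightarrow> \<alpha> a) \<and> (\<forall>b\<in>\<L>. related b (Elem F c) \<longleftrightarrow> \<beta> b)"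
proof -
  let ?above = "\<lambda>a. (code a, cross_pattern F (support a))"
  let ?below = "\<lambda>b. (code b, cross_pattern (support b) F)"
  obtain c where c: "Max (insert N (code ` (\<A> \<union> \<L>))) < c" "upper_spec c = ?above ` {a \<in> \<A>. \<alpha> a}"
    "lower_spec c = ?below ` {b \<in> \<L>. \<beta> b}" "stem c = w"
    using code_with_specs_ex[of "?above ` {a \<in> \<A>. \<alpha> a}" "?below ` {b \<in> \<L>. \<beta> b}"
        "Max (insert N (code ` (\<A> \<union> \<L>)))" w] assms(1,2) by auto
  then have c_above: "N < c" "\<And>a. a \<in> \<A> \<union> \<L> \<Longrightarrow> code a < c"
    using assms(1,2) by auto
  have "related (Elem F c) a \<longleftrightarrow> \<alpha> a" if "a \<in> \<A>" for a
    using c c_above that inj_on_image_mem_iff[OF inj_above that, of "{a \<in> \<A>. \<alpha> a}"]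
    by (auto simp: related_def related_codes_def)
  moreover have "related b (Elem F c) \<longleftrightarrow> \<beta> b" if "b \<in> \<L>" for b
    using c c_above(2)[of b] that inj_on_image_mem_iff[OF inj_below that, of "{b \<in> \<L>. \<beta> b}"]
    by (auto simp: related_def related_codes_def)
  ultimately show ?thesis using c(4) c_above(1) by blast
qed

text \<open>The support of the new element contains enough witnesses to give the finitely many old elements
  different patterns.\<close>
lemma elem_with_relations_ex:
  assumes "S \<noteq> {}" and "finite \<A>" "\<A> \<subseteq> elems (next_level S)" and "finite \<L>" "\<L> \<subseteq> elems S"
  shows "\<exists>v\<in>elems S. N < code v \<and> stem (code v) = w \<and>
    (\<forall>a\<in>\<A>. related v a \<longleftrightarrow> \<alpha> a) \<and> (\<forall>b\<in>\<L>. related b v \<longleftrightarrow> \<beta> b)"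
proof -
  have "\<Union> (set ` support ` \<A>) \<subseteq> next_level S"
    using assms(3) by (auto simp: elems_def)
  from inj_on_cross_pattern_witnesses_ex[OF finite_imageI[OF assms(2)] this assms(1)]
  obtain E where E: "E \<subseteq> S" "finite E" "\<And>F. E \<subseteq> set F \<Longrightarrow> inj_on (cross_pattern F) (support ` \<A>)"
    by blast
  have "finite (E \<union> (\<Union>b\<in>\<L>. set (support b)))" using E(2) assms(4) by simp
  from finite_list[OF this] obtain F where F: "set F = E \<union> (\<Union>b\<in>\<L>. set (support b))" ..
  have inj_F: "inj_on (cross_pattern F) (support ` \<A>)" by (rule E(3)) (simp add: F)
  have inj_above: "inj_on (\<lambda>a. (code a, cross_pattern F (support a))) \<A>"
  proof (rule inj_onI)
    fix a a' assume "a \<in> \<A>" "a' \<in> \<A>"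
      and "(code a, cross_pattern F (support a)) = (code a', cross_pattern F (support a'))"
    then show "a = a'" using inj_onD[OF inj_F, of "support a" "support a'"] by (simp add: elem.expand)
  qed
  have inj_below: "inj_on (\<lambda>b. (code b, cross_pattern (support b) F)) \<L>"
  proof (rule inj_onI)
    fix b b' assume "b \<in> \<L>" "b' \<in> \<L>"
      and eq: "(code b, cross_pattern (support b) F) = (code b', cross_pattern (support b') F)"
    then have "support b = support b'" using F by (intro cross_pattern_left_inject[of _ F]) auto
    then show "b = b'" using eq by (simp add: elem.expand)
  qed
  from code_with_relations_ex[OF assms(2,4) inj_above inj_below, of N w \<alpha> \<beta>]
  obtain c where "N < c" "stem c = w"
    "\<And>a. a \<in> \<A> \<Longrightarrow> related (Elem F c) a \<longleftrightarrow> \<alpha> a" "\<And>b. b \<in> \<L> \<Longrightarrow> related b (Elem F c) \<longleftrightarrow> \<beta> b"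
    by blast
  moreover have "Elem F c \<in> elems S" using E(1) F assms(5) by (auto simp: elems_def)
  ultimately show ?thesis by (intro bexI[of _ "Elem F c"]) simp_all
qed

lemma elem_eqI_related:
  assumes "S \<noteq> {}" and "v \<in> elems (next_level S)" "v' \<in> elems (next_level S)"
    and "\<And>u. u \<in> elems S \<Longrightarrow> related u v \<longleftrightarrow> related u v'"
  shows "v = v'"
proof -
  obtain u where "u \<in> elems S" "\<forall>a\<in>{v, v'}. related u a \<longleftrightarrow> a = v"
    using elem_with_relations_ex[of S "{v, v'}" "{}" _ _ "\<lambda>a. a = v"] assms(1-3) by auto
  then show ?thesis using assms(4)[of u] by auto
qed

section \<open>Towers of hereditary sets\<close>

text \<open>Depends on the levels below \<open>i\<close> only, so towers that agree below \<open>i\<close> can be compared inside it.\<close>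
fun level_bound :: "(nat \<Rightarrow> hs set) \<Rightarrow> nat \<Rightarrow> hs set" where
  "level_bound B 0 = range Atom"
| "level_bound B (Suc i) = next_level (B i)"

definition tower :: "(nat \<Rightarrow> hs set) \<Rightarrow> bool" where
  "tower B \<longleftrightarrow> B 0 \<noteq> {} \<and> (\<forall>i. countable (B i) \<and> B i \<subseteq> B (Suc i) \<and> B i \<subseteq> level_bound B i)"

lemma tower_subset_Suc: "tower B \<Longrightarrow> B i \<subseteq> B (Suc i)"
  by (simp add: tower_def)

lemma tower_subset_level_bound: "tower B \<Longrightarrow> B i \<subseteq> level_bound B i"
  by (simp add: tower_def)

lemma tower_nonempty: "tower B \<Longrightarrow> B i \<noteq> {}"
proof (induction i)
  case (Suc i)
  then show ?case using tower_subset_Suc[of B i] by auto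
qed (simp add: tower_def)

section \<open>Generic labels\<close>

definition overwrite :: "bool list \<Rightarrow> (nat \<Rightarrow> bool) \<Rightarrow> nat \<Rightarrow> bool" where
  "overwrite w z m = (if m < length w then w ! m else z m)"

text \<open>The first \<open>L\<close> rows of level 0 are given completely, since labels cannot be altered afterwards;
  the other bits outside the block are free.\<close>
definition can_force :: "enat \<Rightarrow> nat \<Rightarrow> pt \<Rightarrow> pt set \<Rightarrow> bool" where
  "can_force n L y D \<longleftrightarrow> (\<exists>L'\<ge>L. \<exists>y'\<in>cylinder \<infinity> L y.
     (\<forall>k<L. \<forall>m<L'. y' 0 k m = y 0 k m) \<and> forces n L' y' D)"

lemma can_force_cong:
  assumes "\<And>k. k < L \<Longrightarrow> y 0 k = y' 0 k" and "y' \<in> cylinder \<infinity> L y"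
  shows "can_force n L y D \<longleftrightarrow> can_force n L y' D"
  using assms(1) cylinder_eq[OF assms(2)] by (simp add: can_force_def)

lemma dense_requirement_can_force:
  fixes w :: "nat \<Rightarrow> bool list"
  assumes "openin (Xtop n) D" and "Xtop n closure_of D = topspace (Xtop n)"
  shows "dense_requirement L (\<lambda>q. can_force n L (y(0 := \<lambda>k. overwrite (w k) (q k))) D)"
  unfolding dense_requirement_def
proof (intro allI)
  fix q :: "nat \<Rightarrow> nat \<Rightarrow> bool" and m
  define M where "M = L + m + (\<Sum>k<L. length (w k))"
  have length_le_M: "length (w k) \<le> M" if "k < L" for k
    using member_le_sum[of k "{..<L}" "\<lambda>k. length (w k)"] that by (simp add: M_def)
  let ?y = "\<lambda>q :: nat \<Rightarrow> nat \<Rightarrow> bool. y(0 := \<lambda>k. overwrite (w k) (q k))"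
  obtain L' y' where y': "L' \<ge> M" "y' \<in> cylinder \<infinity> M (?y q)" "forces n L' y' D"
    using dense_open_forces_ex[OF assms] by blast
  define q' where "q' k b = (if b < length (w k) then q k b else y' 0 k b)" for k b
  have "agree_on L m q q'"
    using y'(2) by (auto simp: agree_on_def q'_def cylinder_def overwrite_def M_def)
  moreover have "can_force n L (?y q'') D" if q'': "agree_on L L' q' q''" for q''
  proof -
    have level0: "y' 0 k b = ?y q'' 0 k b" if "k < L" "b < L'" for k b
    proof (cases "b < length (w k)")
      case True
      then have "b < M" "k < M" "0 < M" using length_le_M[OF that(1)] that(1) by (auto simp: M_def)
      then show ?thesis using y'(2) True by (simp add: cylinder_def overwrite_def)
    next
      case False
      have "q'' k b = q' k b" using q'' that by (simp add: agree_on_def)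
      then show ?thesis using False by (simp add: overwrite_def q'_def)
    qed
    have L: "L \<le> L'" "L \<le> M" using y'(1) by (simp_all add: M_def)
    have "y' i k b = ?y q'' i k b" if "i < L" "k < L" "b < L" for i k b
      using level0[of k b] L that y'(2) by (cases i) (simp_all add: cylinder_def)
    then have "y' \<in> cylinder \<infinity> L (?y q'')" by (simp add: cylinder_def)
    then show ?thesis
      using level0 L y'(3) unfolding can_force_def by blast
  qed
  ultimately show "\<exists>q' m'. agree_on L m q q' \<and> decides L m' q' (\<lambda>q. can_force n L (?y q) D)"
    unfolding decides_def by blast
qed

definition differ_beyond :: "nat \<Rightarrow> (nat \<Rightarrow> nat \<Rightarrow> 'b) \<Rightarrow> bool" where
  "differ_beyond N q \<longleftrightarrow> (\<exists>b\<ge>N. q 0 b \<noteq> q 1 b)"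

lemma dense_requirement_differ_beyond:
  "dense_requirement 2 (differ_beyond N :: (nat \<Rightarrow> nat \<Rightarrow> bool) \<Rightarrow> bool)"
  unfolding dense_requirement_def
proof (intro allI)
  fix q :: "nat \<Rightarrow> nat \<Rightarrow> bool" and m
  define q' where "q' k b = (if b < m then q k b else k = 0)" for k b
  have "differ_beyond N q''" if "agree_on 2 (Suc (max m N)) q' q''" for q''
  proof -
    have "q'' k (max m N) \<longleftrightarrow> k = 0" if "k < 2" for k
      using \<open>agree_on 2 (Suc (max m N)) q' q''\<close> that
      unfolding agree_on_def q'_def by (metis lessI max.cobounded1 not_less)
    then show ?thesis by (auto simp: differ_beyond_def intro!: exI[of _ "max m N"])
  qed
  then have "decides 2 (Suc (max m N)) q' (differ_beyond N)" by (simp add: decides_def)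
  moreover have "agree_on 2 m q q'" by (simp add: agree_on_def q'_def)
  ultimately show "\<exists>q' m'. agree_on 2 m q q' \<and> decides 2 m' q' (differ_beyond N)" by blast
qed

locale generic_labels =
  fixes n :: enat and D :: "nat \<Rightarrow> pt set" and \<phi> :: "(nat \<Rightarrow> bool) \<Rightarrow> nat \<Rightarrow> bool"
  assumes continuous_labels: "continuous_on UNIV \<phi>"
    and labels_differ_beyond: "z \<noteq> z' \<Longrightarrow> \<exists>b\<ge>N. \<phi> z b \<noteq> \<phi> z' b"
    and labels_can_force: "inj_on s {..<L} \<Longrightarrow> can_force n L (y(0 := \<lambda>k. overwrite (w k) (\<phi> (s k)))) (D t)"

definition pattern_pt :: "(nat \<times> nat \<times> nat) list \<Rightarrow> pt" where
  "pattern_pt bits i k m \<longleftrightarrow> (i, k, m) \<in> set bits"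

lemma can_force_pattern_pt_ex:
  "\<exists>bits ws. \<forall>q. can_force n L (y(0 := \<lambda>k. overwrite (w k) (q k))) D \<longleftrightarrow>
    can_force n L ((pattern_pt bits)(0 := \<lambda>k. overwrite (ws ! k) (q k))) D"
proof -
  let ?block = "{(i, k, m). i < L \<and> k < L \<and> m < L \<and> y i k m}"
  have "finite ?block" by (rule finite_subset[of _ "{..<L} \<times> {..<L} \<times> {..<L}"]) auto
  from finite_list[OF this] obtain bits where bits: "set bits = ?block" ..
  have "can_force n L (y(0 := \<lambda>k. overwrite (w k) (q k))) D \<longleftrightarrow>
      can_force n L ((pattern_pt bits)(0 := \<lambda>k. overwrite (map w [0..<L] ! k) (q k))) D" for q
    by (rule can_force_cong) (auto simp: cylinder_def pattern_pt_def bits)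
  then show ?thesis by blast
qed

lemma generic_labels_ex:
  fixes D :: "nat \<Rightarrow> pt set"
  assumes D: "\<And>t. openin (Xtop n) (D t)" "\<And>t. Xtop n closure_of D t = topspace (Xtop n)"
  shows "\<exists>\<phi>. generic_labels n D \<phi>"
proof -
  define forcing where "forcing = (\<lambda>(t, L, bits, ws).
      (L :: nat, \<lambda>q. can_force n L ((pattern_pt bits)(0 := \<lambda>k. overwrite (ws ! k) (q k))) (D t)))"
  define R where "R = range (\<lambda>N. (2, differ_beyond N)) \<union> range forcing"
  have "countable R" by (simp add: R_def)
  moreover have "dense_requirement a U" if "(a, U) \<in> R" for a U
    using that dense_requirement_differ_beyond dense_requirement_can_force[OF D]
    by (auto simp: R_def forcing_def)
  ultimately obtain \<phi> :: "(nat \<Rightarrow> bool) \<Rightarrow> nat \<Rightarrow> bool" where "continuous_on UNIV \<phi>"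
    and generic: "\<And>a U z. (a, U) \<in> R \<Longrightarrow> inj_on z {..<a} \<Longrightarrow> U (\<lambda>k. \<phi> (z k))"
    using mycielski[of R] by blast
  moreover have "\<exists>b\<ge>N. \<phi> z b \<noteq> \<phi> z' b" if "z \<noteq> z'" for z z' N
  proof -
    have "inj_on (\<lambda>k. if k = 0 then z else z') {..<2::nat}"
      using that by (auto simp: inj_on_def split: if_splits)
    moreover have "(2, differ_beyond N) \<in> R" by (simp add: R_def)
    ultimately have "differ_beyond N (\<lambda>k. \<phi> (if k = 0 then z else z'))" using generic by blast
    then show ?thesis by (simp add: differ_beyond_def)
  qed
  moreover have "can_force n L (y(0 := \<lambda>k. overwrite (w k) (\<phi> (s k)))) (D t)"
    if "inj_on s {..<L}" for s L w y t
  proof -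
    obtain bits ws where coded: "\<And>q. can_force n L (y(0 := \<lambda>k. overwrite (w k) (q k))) (D t) \<longleftrightarrow>
        can_force n L ((pattern_pt bits)(0 := \<lambda>k. overwrite (ws ! k) (q k))) (D t)"
      using can_force_pattern_pt_ex by metis
    have "forcing (t, L, bits, ws) \<in> R" by (simp add: R_def)
    then show ?thesis
      using generic[of L _ s] that by (simp add: forcing_def coded)
  qed
  ultimately have "generic_labels n D \<phi>" by unfold_locales
  then show ?thesis by blast
qed

fun atom_bit :: "hs \<Rightarrow> nat \<Rightarrow> bool" where
  "atom_bit (Atom z) j = z j"
| "atom_bit (HSet T) j = False"

definition elem_bits :: "hs elem \<Rightarrow> nat \<Rightarrow> bool" where
  "elem_bits v b = (case from_nat b of
      Inl p \<Rightarrow> p = (length (support v), code v)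
    | Inr (i, j) \<Rightarrow> i < length (support v) \<and> atom_bit (support v ! i) j)"

lemma inj_on_elem_bits: "inj_on elem_bits (elems (range Atom))"
proof (rule inj_onI)
  fix v v' :: "hs elem"
  assume v: "v \<in> elems (range Atom)" "v' \<in> elems (range Atom)" and eq: "elem_bits v = elem_bits v'"
  have bit: "elem_bits v (to_nat x) = elem_bits v' (to_nat x)" for x :: "(nat \<times> nat) + (nat \<times> nat)"
    using eq by simp
  have len: "length (support v) = length (support v')" and code: "code v = code v'"
    using bit[of "Inl (length (support v), code v)"] by (auto simp: elem_bits_def)
  have "support v = support v'"
  proof (rule nth_equalityI[OF len])
    fix i assume i: "i < length (support v)"
    then have "support v ! i \<in> range Atom" "support v' ! i \<in> range Atom"
      using v len by (auto simp: elems_def subset_iff)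
    then obtain z z' where z: "support v ! i = Atom z" "support v' ! i = Atom z'" by blast
    have "z j = z' j" for j
      using bit[of "Inr (i, j)"] i len z by (simp add: elem_bits_def)
    then show "support v ! i = support v' ! i" using z by auto
  qed
  then show "v = v'" using code by (rule elem.expand[OF conjI])
qed

context generic_labels
begin

definition label :: "hs elem \<Rightarrow> nat \<Rightarrow> bool" where
  "label v = overwrite (stem (code v)) (\<phi> (elem_bits v))"

lemma inj_on_label: "inj_on label (elems (range Atom))"
proof (rule inj_onI, rule ccontr)
  fix v v' assume v: "v \<in> elems (range Atom)" "v' \<in> elems (range Atom)" "label v = label v'" "v \<noteq> v'"
  then have "elem_bits v \<noteq> elem_bits v'" using inj_on_elem_bits by (auto dest: inj_onD)
  from labels_differ_beyond[OF this, of "length (stem (code v)) + length (stem (code v'))"]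
  obtain b where "b \<ge> length (stem (code v)) + length (stem (code v'))"
    "\<phi> (elem_bits v) b \<noteq> \<phi> (elem_bits v') b"
    by blast
  then have "label v b \<noteq> label v' b" by (simp add: label_def overwrite_def)
  then show False using v(3) by simp
qed

fun interp :: "(nat \<Rightarrow> hs set) \<Rightarrow> nat \<Rightarrow> hs elem \<Rightarrow> hs" where
  "interp B 0 v = Atom (label v)"
| "interp B (Suc i) v = HSet (acset (interp B i ` {u \<in> elems (B i). related u v}))"

lemma interp_cong: "(\<And>j. j < i \<Longrightarrow> B j = B' j) \<Longrightarrow> interp B i = interp B' i"
  by (induction i) (auto intro!: ext)

lemma inj_on_interp: "tower B \<Longrightarrow> inj_on (interp B i) (elems (level_bound B i))"
proof (induction i)
  case 0
  show ?case using inj_on_label by (simp add: inj_on_def)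
next
  case (Suc i)
  have inj: "inj_on (interp B i) (elems (B i))"
    using Suc elems_mono tower_subset_level_bound by (blast intro: inj_on_subset)
  show ?case
  proof (rule inj_onI)
    fix v v' assume v: "v \<in> elems (level_bound B (Suc i))" "v' \<in> elems (level_bound B (Suc i))"
      and eq: "interp B (Suc i) v = interp B (Suc i) v'"
    have "countable (interp B i ` {u \<in> elems (B i). related u v})" for v
      using countable_elems[of "B i"] Suc.prems by (auto simp: tower_def intro: countable_subset)
    then have "interp B i ` {u \<in> elems (B i). related u v} = interp B i ` {u \<in> elems (B i). related u v'}"
      using eq by (simp add: acset_inject)
    then have "{u \<in> elems (B i). related u v} = {u \<in> elems (B i). related u v'}"
      by (subst (asm) inj_on_image_eq_iff[OF inj]) auto
    then show "v = v'"
      using v tower_nonempty[OF Suc.prems] by (intro elem_eqI_related[of "B i"]) auto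
  qed
qed

definition coded_level :: "(nat \<Rightarrow> hs set) \<Rightarrow> nat \<Rightarrow> hs set" where
  "coded_level B i = interp B i ` elems (B i)"

lemma tower_eqI_coded_levels:
  assumes "tower B" "tower B'"
    and coded: "\<And>i. enat i < N \<Longrightarrow> coded_level B i = coded_level B' i"
  shows "enat i < N \<Longrightarrow> B i = B' i"
proof (induction i rule: less_induct)
  case (less i)
  have lower: "B j = B' j" if "j < i" for j
    using less.IH[OF that] enat_le_less_trans[OF _ less.prems] that by simp
  then have "interp B' i = interp B i" using interp_cong[of i B' B] by simp
  then have "interp B i ` elems (B i) = interp B i ` elems (B' i)"
    using coded[OF less.prems] by (simp add: coded_level_def)
  moreover have "level_bound B' i = level_bound B i" using lower by (cases i) auto
  then have "elems (B i) \<subseteq> elems (level_bound B i)" "elems (B' i) \<subseteq> elems (level_bound B i)"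
    using tower_subset_level_bound assms(1,2) elems_mono by metis+
  ultimately have "elems (B i) = elems (B' i)"
    using inj_on_image_eq_iff[OF inj_on_interp[OF assms(1)]] by blast
  then show ?case by (simp add: elems_eq_iff)
qed

end

section \<open>Generic enumerations\<close>

definition grid :: "nat \<Rightarrow> (nat \<times> nat) set" where
  "grid L = {..<L} \<times> {..<L}"

lemma mem_grid_iff [simp]: "(i, k) \<in> grid L \<longleftrightarrow> i < L \<and> k < L"
  by (simp add: grid_def)

lemma finite_grid [simp]: "finite (grid L)"
  by (simp add: grid_def)

lemma grid_mono: "L \<le> L' \<Longrightarrow> grid L \<subseteq> grid L'"
  by (auto simp: grid_def)

definition partial_enum :: "(nat \<Rightarrow> hs set) \<Rightarrow> (nat \<times> nat) set \<Rightarrow> (nat \<Rightarrow> nat \<Rightarrow> hs elem) \<Rightarrow> bool" where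
  "partial_enum B P v \<longleftrightarrow> (\<forall>i k. (i, k) \<in> P \<longrightarrow> v i k \<in> elems (B i)) \<and>
     (\<forall>i k l. (i, k) \<in> P \<longrightarrow> (i, l) \<in> P \<longrightarrow> v i k = v i l \<longrightarrow> k = l)"

lemma partial_enum_mem: "partial_enum B P v \<Longrightarrow> (i, k) \<in> P \<Longrightarrow> v i k \<in> elems (B i)"
  by (simp add: partial_enum_def)

lemma partial_enum_inj:
  "partial_enum B P v \<Longrightarrow> (i, k) \<in> P \<Longrightarrow> (i, l) \<in> P \<Longrightarrow> v i k = v i l \<Longrightarrow> k = l"
  by (simp add: partial_enum_def)

definition extends_on :: "(nat \<times> nat) set \<Rightarrow> (nat \<Rightarrow> nat \<Rightarrow> 'a) \<Rightarrow> (nat \<Rightarrow> nat \<Rightarrow> 'a) \<Rightarrow> bool" where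
  "extends_on P v v' \<longleftrightarrow> (\<forall>i k. (i, k) \<in> P \<longrightarrow> v' i k = v i k)"

lemma partial_enum_cong: "extends_on P v v' \<Longrightarrow> partial_enum B P v \<Longrightarrow> partial_enum B P v'"
  unfolding partial_enum_def extends_on_def by metis

lemma extends_on_image_mono:
  assumes "extends_on P v v'" and "P \<subseteq> Q"
  shows "v i ` P `` {i} \<subseteq> v' i ` Q `` {i}"
proof
  fix a assume "a \<in> v i ` P `` {i}"
  then obtain k where "(i, k) \<in> P" "a = v i k" by blast
  then have "a = v' i k" "(i, k) \<in> Q" using assms by (auto simp: extends_on_def)
  then show "a \<in> v' i ` Q `` {i}" by blast
qed

lemma extends_on_trans: "extends_on P v v' \<Longrightarrow> extends_on Q v' v'' \<Longrightarrow> P \<subseteq> Q \<Longrightarrow> extends_on P v v''"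
  by (auto simp: extends_on_def)

lemma extends_on_limit:
  assumes "strict_mono L" and "\<And>t. extends_on (grid (L t)) (v t) (v (Suc t))"
  shows "extends_on (grid (L t)) (v t) (\<lambda>i k. v (Suc (i + k)) i k)"
  unfolding extends_on_def
proof (intro allI impI)
  have v_extends: "extends_on (grid (L t)) (v t) (v t')" if "t \<le> t'" for t t'
    using that
  proof (induction t' rule: dec_induct)
    case (step t')
    have "grid (L t) \<subseteq> grid (L t')"
      using assms(1) step.hyps(1) by (intro grid_mono) (simp add: strict_mono_less_eq)
    then show ?case using extends_on_trans[OF step.IH assms(2)] by blast
  qed (simp add: extends_on_def)
  fix i k assume ik: "(i, k) \<in> grid (L t)"
  have "(i, k) \<in> grid (L (Suc (i + k)))"
    using strict_mono_imp_increasing[OF assms(1), of "Suc (i + k)"] by auto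
  then show "v (Suc (i + k)) i k = v t i k"
    using v_extends[of t "Suc (i + k)"] v_extends[of "Suc (i + k)" t] ik
    by (cases "t \<le> Suc (i + k)") (auto simp: extends_on_def)
qed

lemma bij_betw_limit:
  assumes partial: "\<And>t. partial_enum B (grid (L t)) (v t)" and L_ge: "\<And>t. t \<le> L t"
    and u: "\<And>t. extends_on (grid (L t)) (v t) u"
    and hit: "\<And>a. a \<in> elems (B i) \<Longrightarrow> \<exists>t. a \<in> v t i ` grid (L t) `` {i}"
  shows "bij_betw (u i) UNIV (elems (B i))"
proof (rule bij_betw_imageI)
  have u_partial: "partial_enum B (grid (L t)) u" for t
    using u partial by (rule partial_enum_cong)
  show "inj (u i)"
  proof (rule injI)
    fix k l assume "u i k = u i l"
    then show "k = l"
      using partial_enum_inj[OF u_partial[of "Suc (i + k + l)"], of i k l] L_ge[of "Suc (i + k + l)"]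
      by simp
  qed
  have "u i k \<in> elems (B i)" for k
    using partial_enum_mem[OF u_partial[of "Suc (i + k)"], of i k] L_ge[of "Suc (i + k)"] by simp
  moreover have "a \<in> range (u i)" if "a \<in> elems (B i)" for a
    using hit[OF that] extends_on_image_mono[OF u subset_refl] by blast
  ultimately show "range (u i) = elems (B i)" by blast
qed

context generic_labels
begin

fun coding_pt :: "(nat \<Rightarrow> nat \<Rightarrow> hs elem) \<Rightarrow> pt" where
  "coding_pt v 0 k = label (v 0 k)"
| "coding_pt v (Suc i) k = (\<lambda>m. related (v i m) (v (Suc i) k))"

lemma coding_pt_mem_cylinder:
  assumes "extends_on (grid L) v v'"
  shows "coding_pt v' \<in> cylinder \<infinity> L (coding_pt v)"
proof -
  have "coding_pt v' i k m = coding_pt v i k m" if "i < L" "k < L" "m < L" for i k m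
    using assms that by (cases i) (simp_all add: extends_on_def)
  then show ?thesis by (simp add: cylinder_def)
qed

lemma forces_coding_pt_cong:
  assumes "extends_on (grid L) v v'"
  shows "forces n L (coding_pt v) W \<longleftrightarrow> forces n L (coding_pt v') W"
  using coding_pt_mem_cylinder[OF assms] cylinder_infinity_subset forces_cong by blast

definition realises ::
  "(nat \<Rightarrow> hs set) \<Rightarrow> (nat \<times> nat) set \<Rightarrow> nat \<Rightarrow> pt \<Rightarrow> (nat \<Rightarrow> nat \<Rightarrow> hs elem) \<Rightarrow> bool" where
  "realises B P N y v \<longleftrightarrow> partial_enum B P v \<and>
     (\<forall>k. (0, k) \<in> P \<longrightarrow> (\<forall>m<N. y 0 k m = label (v 0 k) m)) \<and>
     (\<forall>i k l. (i, k) \<in> P \<longrightarrow> (Suc i, l) \<in> P \<longrightarrow> y (Suc i) l k = related (v i k) (v (Suc i) l))"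

lemma realises_coding_pt_iff: "realises B P N (coding_pt v) v \<longleftrightarrow> partial_enum B P v"
  by (simp add: realises_def)

lemma realises_grid_imp_mem_cylinder:
  assumes "realises B (grid L) L y v"
  shows "coding_pt v \<in> cylinder \<infinity> L y"
proof -
  have "coding_pt v i k m = y i k m" if "i < L" "k < L" "m < L" for i k m
    using assms that by (cases i) (simp_all add: realises_def)
  then show ?thesis by (simp add: cylinder_def)
qed

lemma realising_elem_ex:
  assumes "tower B" and "finite P" and "realises B P N y v"
  shows "\<exists>w\<in>elems (B i). (\<forall>j l. (j, l) \<in> P \<longrightarrow> v j l \<noteq> w) \<and> (\<forall>m<N. y 0 k m = label w m) \<and>
    (\<forall>l. (Suc i, l) \<in> P \<longrightarrow> y (Suc i) l k = related w (v (Suc i) l)) \<and>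
    (\<forall>j l. i = Suc j \<longrightarrow> (j, l) \<in> P \<longrightarrow> y i k l = related (v j l) w)"
proof -
  have v_mem: "\<And>j l. (j, l) \<in> P \<Longrightarrow> v j l \<in> elems (B j)" and v_inj: "\<And>j. inj_on (v j) (P `` {j})"
    using assms(3) by (auto simp: realises_def partial_enum_def inj_on_def)
  define above where "above = v (Suc i) ` P `` {Suc i}"
  define below where "below = (\<Union>j\<in>{j. i = Suc j}. v j ` P `` {j})"
  define row where "row j = the_inv_into (P `` {j}) (v j)" for j
  have row: "row j (v j l) = l" if "(j, l) \<in> P" for j l
    using the_inv_into_f_f[OF v_inj] that by (simp add: row_def)
  have "finite {j. i = Suc j}" by (cases i) auto
  then have fin: "finite above" "finite below"
    using assms(2) by (auto simp: above_def below_def finite_Image)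
  have "above \<subseteq> elems (next_level (B i))"
    using v_mem tower_subset_level_bound[OF assms(1), THEN elems_mono, of "Suc i"]
    by (auto simp: above_def)
  moreover have "below \<subseteq> elems (B i)"
    using v_mem tower_subset_Suc[OF assms(1), THEN elems_mono] by (auto simp: below_def)
  ultimately obtain w where w: "w \<in> elems (B i)" "(\<Sum>(j, l)\<in>P. code (v j l)) < code w"
    "stem (code w) = map (y 0 k) [0..<N]"
    and rel_above: "\<And>a. a \<in> above \<Longrightarrow> related w a \<longleftrightarrow> y (Suc i) (row (Suc i) a) k"
    and rel_below: "\<And>b. b \<in> below \<Longrightarrow> related b w \<longleftrightarrow> y i k (row (i - 1) b)"
    using elem_with_relations_ex[OF tower_nonempty[OF assms(1)] fin(1) _ fin(2), of i
        "\<Sum>(j, l)\<in>P. code (v j l)" "map (y 0 k) [0..<N]"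
        "\<lambda>a. y (Suc i) (row (Suc i) a) k" "\<lambda>b. y i k (row (i - 1) b)"]
    by blast
  have "v j l \<noteq> w" if "(j, l) \<in> P" for j l
    using member_le_sum[of "(j, l)" P "\<lambda>(j, l). code (v j l)"] assms(2) that w(2) by auto
  moreover have "y 0 k m = label w m" if "m < N" for m
    using that w(3) by (simp add: label_def overwrite_def)
  moreover have "y (Suc i) l k = related w (v (Suc i) l)" if "(Suc i, l) \<in> P" for l
    using rel_above[of "v (Suc i) l"] row that by (simp add: above_def)
  moreover have "y i k l = related (v j l) w" if "i = Suc j" "(j, l) \<in> P" for j l
    using rel_below[of "v j l"] row that by (auto simp: below_def)
  ultimately show ?thesis using w(1) by blast
qed

lemma realises_insert:
  assumes "tower B" and "finite P" and real: "realises B P N y v" and new: "(i, k) \<notin> P"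
  shows "\<exists>v'. realises B (insert (i, k) P) N y v' \<and> extends_on P v v'"
proof -
  obtain w where w: "w \<in> elems (B i)" "\<And>j l. (j, l) \<in> P \<Longrightarrow> v j l \<noteq> w" "\<And>m. m < N \<Longrightarrow> y 0 k m = label w m"
    and above: "\<And>l. (Suc i, l) \<in> P \<Longrightarrow> y (Suc i) l k = related w (v (Suc i) l)"
    and below: "\<And>j l. i = Suc j \<Longrightarrow> (j, l) \<in> P \<Longrightarrow> y i k l = related (v j l) w"
    using realising_elem_ex[OF assms(1-3), of i k] by blast
  define v' where "v' = v(i := (v i)(k := w))"
  have v'_new: "v' i k = w" by (simp add: v'_def)
  have v'_old: "v' j l = v j l" if "(j, l) \<in> P" for j l using new that by (auto simp: v'_def)
  have "partial_enum B (insert (i, k) P) v'"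
    unfolding partial_enum_def
  proof (intro conjI allI impI)
    show "v' j l \<in> elems (B j)" if "(j, l) \<in> insert (i, k) P" for j l
      using real w(1) that v'_new v'_old by (auto simp: realises_def partial_enum_def)
    show "a = b" if "(j, a) \<in> insert (i, k) P" "(j, b) \<in> insert (i, k) P" "v' j a = v' j b" for j a b
      using that real w(2)[of j a] w(2)[of j b]
      by (auto simp: v'_new v'_old realises_def partial_enum_def)
  qed
  moreover have "y 0 l m = label (v' 0 l) m" if "(0, l) \<in> insert (i, k) P" "m < N" for l m
    using real that w(3) v'_new v'_old by (auto simp: realises_def)
  moreover have "y (Suc j) l a = related (v' j a) (v' (Suc j) l)"
    if "(j, a) \<in> insert (i, k) P" "(Suc j, l) \<in> insert (i, k) P" for j a l
    using real that above[of l] below[of j a] v'_new v'_old by (auto simp: realises_def)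
  ultimately have "realises B (insert (i, k) P) N y v'" by (simp add: realises_def)
  then show ?thesis using v'_old by (auto simp: extends_on_def)
qed

lemma realises_extend:
  assumes "tower B" and "finite P" and "realises B P N y v" and "finite Q"
  shows "\<exists>v'. realises B (P \<union> Q) N y v' \<and> extends_on P v v'"
  using assms(4)
proof (induction Q rule: finite_induct)
  case empty
  show ?case using assms(3) by (auto simp: extends_on_def)
next
  case (insert q Q)
  then obtain v' where v': "realises B (P \<union> Q) N y v'" "extends_on P v v'" by blast
  show ?case
  proof (cases "q \<in> P \<union> Q")
    case True
    then show ?thesis using v' by (metis Un_insert_right insert_absorb)
  next
    case False
    then obtain v'' where "realises B (insert q (P \<union> Q)) N y v''" "extends_on (P \<union> Q) v' v''"
      using realises_insert[OF assms(1) _ v'(1), of "fst q" "snd q"] assms(2) insert.hyps(1) by auto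
    then show ?thesis using extends_on_trans[OF v'(2)] by auto
  qed
qed

lemma partial_enum_extend_hitting:
  assumes "tower B" and "partial_enum B (grid L) v" and "a \<in> elems (B i)"
  shows "\<exists>L' v'. L < L' \<and> partial_enum B (grid L') v' \<and> extends_on (grid L) v v' \<and>
    a \<in> v' i ` grid L' `` {i}"
proof -
  obtain P v\<^sub>a where P: "grid L \<subseteq> P" "P \<subseteq> insert (i, L) (grid L)" "partial_enum B P v\<^sub>a"
    "extends_on (grid L) v v\<^sub>a" "a \<in> v\<^sub>a i ` P `` {i}"
  proof (cases "a \<in> v i ` grid L `` {i}")
    case True
    then show ?thesis using that[of "grid L" v] assms(2) by (auto simp: extends_on_def)
  next
    case False
    have "partial_enum B (insert (i, L) (grid L)) (v(i := (v i)(L := a)))"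
      using assms(2,3) False by (auto simp: partial_enum_def)
    then show ?thesis
      by (intro that[of "insert (i, L) (grid L)" "v(i := (v i)(L := a))"]) (auto simp: extends_on_def)
  qed
  define L' where "L' = Suc (max i L)"
  have "insert (i, L) (grid L) \<subseteq> grid L'" by (auto simp: L'_def)
  then have P_grid: "P \<subseteq> grid L'" using P(2) by blast
  then have "finite P" by (rule finite_subset) simp
  then obtain v' where v': "realises B (P \<union> grid L') 0 (coding_pt v\<^sub>a) v'" "extends_on P v\<^sub>a v'"
    using realises_extend[OF assms(1) _ realises_coding_pt_iff[THEN iffD2, OF P(3)]] finite_grid
    by blast
  have "partial_enum B (grid L') v'"
    using v'(1) P_grid by (simp add: realises_def Un_absorb1)
  moreover have "a \<in> v' i ` grid L' `` {i}"
    using P(5) extends_on_image_mono[OF v'(2) P_grid] by blast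
  moreover have "extends_on (grid L) v v'"
    using extends_on_trans[OF P(4) v'(2) P(1)] .
  ultimately show ?thesis by (intro exI[of _ L'] exI[of _ v']) (auto simp: L'_def)
qed

lemma coding_pt_can_force:
  assumes "tower B" and "partial_enum B (grid L) v"
  shows "can_force n L (coding_pt v) (D t)"
proof -
  have "inj_on (\<lambda>k. elem_bits (v 0 k)) {..<L}"
  proof (rule inj_onI)
    fix k l assume kl: "k \<in> {..<L}" "l \<in> {..<L}" "elem_bits (v 0 k) = elem_bits (v 0 l)"
    then have "(0, k) \<in> grid L" "(0, l) \<in> grid L" by auto
    moreover have "elems (B 0) \<subseteq> elems (range Atom)"
      using tower_subset_level_bound[OF assms(1), of 0] by (simp add: elems_mono)
    ultimately have "v 0 k = v 0 l"
      using assms(2) kl(3) by (intro inj_onD[OF inj_on_elem_bits]) (auto simp: partial_enum_def)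
    then show "k = l"
      by (rule partial_enum_inj[OF assms(2) \<open>(0, k) \<in> grid L\<close> \<open>(0, l) \<in> grid L\<close>])
  qed
  then have "can_force n L ((coding_pt v)(0 := \<lambda>k. label (v 0 k))) (D t)"
    unfolding label_def by (rule labels_can_force)
  moreover have "(coding_pt v)(0 := \<lambda>k. label (v 0 k)) = coding_pt v"
    by (intro fun_upd_idem ext) simp
  ultimately show ?thesis by simp
qed

lemma partial_enum_extend_forcing:
  assumes "tower B" and "partial_enum B (grid L) v"
  shows "\<exists>L' v'. L \<le> L' \<and> partial_enum B (grid L') v' \<and> extends_on (grid L) v v' \<and>
    forces n L' (coding_pt v') (D t)"
proof -
  obtain L' y where y: "L \<le> L'" "y \<in> cylinder \<infinity> L (coding_pt v)"
    "\<forall>k<L. \<forall>m<L'. y 0 k m = coding_pt v 0 k m" "forces n L' y (D t)"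
    using coding_pt_can_force[OF assms] unfolding can_force_def by blast
  have "realises B (grid L) L' y v"
    using assms(2) y(2,3) by (auto simp: realises_def cylinder_def)
  then obtain v' where v': "realises B (grid L \<union> grid L') L' y v'" "extends_on (grid L) v v'"
    using realises_extend[OF assms(1) finite_grid _ finite_grid] by blast
  then have real: "realises B (grid L') L' y v'" using grid_mono[OF y(1)] by (simp add: Un_absorb1)
  then have "coding_pt v' \<in> cylinder n L' y"
    using realises_grid_imp_mem_cylinder cylinder_infinity_subset by blast
  then have "forces n L' (coding_pt v') (D t)" using y(4) forces_cong by blast
  moreover have "partial_enum B (grid L') v'" using real by (simp add: realises_def)
  ultimately show ?thesis using y(1) v'(2) by blast
qed

definition generic_step ::
  "(nat \<Rightarrow> hs set) \<Rightarrow> nat \<Rightarrow> nat \<times> hs elem \<Rightarrow> nat \<Rightarrow> (nat \<Rightarrow> nat \<Rightarrow> hs elem) \<Rightarrow>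
    nat \<Rightarrow> (nat \<Rightarrow> nat \<Rightarrow> hs elem) \<Rightarrow> bool" where
  "generic_step B t g L v L' v' \<longleftrightarrow> L < L' \<and> extends_on (grid L) v v' \<and> forces n L' (coding_pt v') (D t) \<and>
     (snd g \<in> elems (B (fst g)) \<longrightarrow> snd g \<in> v' (fst g) ` grid L' `` {fst g})"

lemma generic_step_ex:
  assumes "tower B" and "partial_enum B (grid L) v"
  shows "\<exists>L' v'. partial_enum B (grid L') v' \<and> generic_step B t g L v L' v'"
proof -
  obtain i a where a: "a \<in> elems (B i)" "snd g \<in> elems (B (fst g)) \<Longrightarrow> g = (i, a)"
  proof (cases "snd g \<in> elems (B (fst g))")
    case False
    then show ?thesis using that[of "Elem [] 0" 0] by (simp add: elems_def)
  qed (use that in auto)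
  obtain M u where u: "L < M" "partial_enum B (grid M) u" "extends_on (grid L) v u"
    "a \<in> u i ` grid M `` {i}"
    using partial_enum_extend_hitting[OF assms a(1)] by blast
  obtain L' v' where v': "M \<le> L'" "partial_enum B (grid L') v'" "extends_on (grid M) u v'"
    "forces n L' (coding_pt v') (D t)"
    using partial_enum_extend_forcing[OF assms(1) u(2)] by blast
  have "a \<in> v' i ` grid L' `` {i}"
    using u(4) extends_on_image_mono[OF v'(3) grid_mono[OF v'(1)]] by blast
  moreover have "extends_on (grid L) v v'"
    using extends_on_trans[OF u(3) v'(3)] u(1) by (simp add: grid_mono)
  ultimately have "generic_step B t g L v L' v'"
    using u(1) v'(1,4) a(2) by (auto simp: generic_step_def)
  then show ?thesis using v'(2) by blast
qed

definition generic_enum :: "(nat \<Rightarrow> hs set) \<Rightarrow> (nat \<Rightarrow> nat \<Rightarrow> hs elem) \<Rightarrow> bool" where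
  "generic_enum B v \<longleftrightarrow> (\<forall>i. bij_betw (v i) UNIV (elems (B i))) \<and> (\<forall>t. \<exists>L. forces n L (coding_pt v) (D t))"

lemma generic_enum_limit:
  assumes partial: "\<And>t. partial_enum B (grid (L t)) (v t)"
    and step: "\<And>t. generic_step B t (g t) (L t) (v t) (L (Suc t)) (v (Suc t))"
    and targets: "\<And>i a. a \<in> elems (B i) \<Longrightarrow> (i, a) \<in> range g"
  shows "generic_enum B (\<lambda>i k. v (Suc (i + k)) i k)"
proof -
  define u where "u = (\<lambda>i k. v (Suc (i + k)) i k)"
  have strict_mono_L: "strict_mono L" using step by (simp add: strict_mono_Suc_iff generic_step_def)
  have u_extends: "extends_on (grid (L t)) (v t) u" for t
    unfolding u_def using strict_mono_L step by (intro extends_on_limit) (auto simp: generic_step_def)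
  have "bij_betw (u i) UNIV (elems (B i))" for i
  proof (rule bij_betw_limit[OF partial _ u_extends])
    show "t \<le> L t" for t using strict_mono_L by (rule strict_mono_imp_increasing)
    fix a assume a: "a \<in> elems (B i)"
    then obtain t where "g t = (i, a)" using targets by (metis rangeE)
    then have "a \<in> v (Suc t) i ` grid (L (Suc t)) `` {i}"
      using step[of t] a by (simp add: generic_step_def)
    then show "\<exists>t. a \<in> v t i ` grid (L t) `` {i}" by blast
  qed
  moreover have "\<exists>L. forces n L (coding_pt u) (D t)" for t
    using step[of t] forces_coding_pt_cong[OF u_extends[of "Suc t"]] by (auto simp: generic_step_def)
  ultimately show ?thesis by (simp add: generic_enum_def flip: u_def)
qed

end

section \<open>The sets coded by a point\<close>

lemma Xset_row_nonempty: "x \<in> Xset n \<Longrightarrow> enat (Suc i) < n \<Longrightarrow> \<exists>m. x (Suc i) k m"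
  unfolding Xset_iff by blast

lemma Xset_column_nonempty: "x \<in> Xset n \<Longrightarrow> enat (Suc i) < n \<Longrightarrow> \<exists>k. x (Suc i) k m"
  unfolding Xset_iff by blast

lemma aa_Suc: "aa x (Suc j) l = HSet (acset (aa x j ` {k. x (Suc j) l k}))"
  by (simp add: setcompr_eq_image)

declare aa.simps(2) [simp del]

lemma hmem_aa_Suc: "hmem h (aa x (Suc j) l) \<longleftrightarrow> (\<exists>k. x (Suc j) l k \<and> h = aa x j k)"
  by (auto simp: aa_Suc)

lemma aa_Suc_eq_iff:
  "aa x (Suc i) k = aa y (Suc j) l \<longleftrightarrow> aa x i ` {m. x (Suc i) k m} = aa y j ` {m. y (Suc j) l m}"
  by (simp add: aa_Suc acset_inject)

lemma Atom_neq_aa_Suc [simp]: "Atom z \<noteq> aa x (Suc j) l" "aa x (Suc j) l \<noteq> Atom z"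
  by (simp_all add: aa_Suc)

lemma aa_restrict: "enat i < n \<Longrightarrow> aa (restrict x {i. enat i < n}) i k = aa x i k"
proof (induction i arbitrary: k)
  case (Suc i)
  then have "enat i < n" using enat_le_less_trans[of i "Suc i"] by simp
  then show ?case using Suc by (simp add: aa_Suc)
qed simp

text \<open>Cumulative, so that the support of a new element can include those of the elements below it.\<close>
definition levels :: "pt \<Rightarrow> nat \<Rightarrow> hs set" where
  "levels x i = case_prod (aa x) ` ({..i} \<times> UNIV)"

lemma levels_eq_Union: "levels x i = (\<Union>j\<le>i. range (aa x j))"
  by (force simp: levels_def)

lemma tower_levels: "tower (levels x)"
  unfolding tower_def
proof (intro conjI allI)
  show "levels x 0 \<noteq> {}" by (simp add: levels_def)
  fix i
  show "countable (levels x i)" by (simp add: levels_def)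
  show "levels x i \<subseteq> levels x (Suc i)"
    unfolding levels_def by (intro image_mono Sigma_mono) auto
  show "levels x i \<subseteq> level_bound (levels x) i"
  proof (cases i)
    case 0
    then show ?thesis by (auto simp: levels_eq_Union)
  next
    case (Suc j)
    have "aa x (Suc j) k \<in> next_level (levels x j)" for k
      by (auto simp: aa_Suc next_level_def levels_eq_Union)
    moreover have "levels x (Suc j) = levels x j \<union> range (aa x (Suc j))"
      by (auto simp: levels_eq_Union atMost_Suc)
    ultimately show ?thesis using Suc subset_next_level by auto
  qed
qed

fun of_rank :: "nat \<Rightarrow> hs set" where
  "of_rank 0 = range Atom"
| "of_rank (Suc i) = {HSet T | T. rcset T \<noteq> {} \<and> rcset T \<subseteq> of_rank i}"

lemma of_rank_unique: "h \<in> of_rank i \<Longrightarrow> h \<in> of_rank j \<Longrightarrow> i = j"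
proof (induction i arbitrary: h j)
  case 0
  then show ?case by (cases j) auto
next
  case (Suc i)
  then obtain j' where "j = Suc j'" by (cases j) auto
  with Suc show ?case by fastforce
qed

lemma aa_in_of_rank: "x \<in> Xset n \<Longrightarrow> enat i < n \<Longrightarrow> aa x i k \<in> of_rank i"
proof (induction i arbitrary: k)
  case (Suc i)
  then have "enat i < n" using enat_le_less_trans[of i "Suc i"] by simp
  moreover have "\<exists>m. x (Suc i) k m" using Suc.prems by (rule Xset_row_nonempty)
  ultimately show ?case using Suc by (auto simp: aa_Suc)
qed simp

lemma range_aa_eq_levels_Int_of_rank:
  assumes "x \<in> Xset n" and "enat i < n"
  shows "range (aa x i) = levels x i \<inter> of_rank i"
proof -
  have "aa x j k \<in> of_rank j" if "j \<le> i" for j k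
    using aa_in_of_rank[OF assms(1)] enat_le_less_trans[OF that assms(2)] by blast
  then have "j = i" if "j \<le> i" "aa x j k \<in> of_rank i" for j k
    using of_rank_unique that by blast
  then have "levels x i \<inter> of_rank i \<subseteq> range (aa x i)"
    by (auto simp: levels_def)
  moreover have "range (aa x i) \<subseteq> levels x i \<inter> of_rank i"
    using aa_in_of_rank[OF assms] by (auto simp: levels_eq_Union)
  ultimately show ?thesis by blast
qed

lemma range_aa_eq_members:
  assumes "x \<in> Xset n" and "enat (Suc i) < n"
  shows "range (aa x i) = {h. \<exists>S\<in>range (aa x (Suc i)). hmem h S}"
proof -
  have "h \<in> range (aa x i) \<longleftrightarrow> (\<exists>k m. x (Suc i) k m \<and> h = aa x i m)" for h
    using Xset_column_nonempty[OF assms] by blast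
  then show ?thesis by (simp add: set_eq_iff hmem_aa_Suc)
qed

lemma AA_Suc_eq_iff: "AA x (Suc i) = AA y (Suc i) \<longleftrightarrow> range (aa x i) = range (aa y i)"
  by (simp add: AA_def acset_inject)

lemma FF_iff_range_aa_eq:
  assumes "1 \<le> n" and "x \<in> Xset n" "y \<in> Xset n"
  shows "FF n x y \<longleftrightarrow> (\<forall>i. enat i < n \<longrightarrow> range (aa x i) = range (aa y i))"
proof (cases n)
  case (enat m)
  then obtain i where m: "m = Suc i" using assms(1) by (cases m) (auto simp: one_enat_def)
  have "range (aa x j) = range (aa y j)" if top: "range (aa x i) = range (aa y i)" and "j \<le> i" for j
    using that(2)
  proof (induction rule: inc_induct)
    case (step j)
    then have lt: "enat (Suc j) < n" using enat m by simp
    show ?case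
      unfolding range_aa_eq_members[OF assms(2) lt] range_aa_eq_members[OF assms(3) lt] step.IH ..
  qed (rule top)
  then have "range (aa x i) = range (aa y i) \<longleftrightarrow> (\<forall>j\<le>i. range (aa x j) = range (aa y j))" by blast
  then show ?thesis using enat m by (simp add: FF_def AA_Suc_eq_iff less_Suc_eq_le)
next
  case infinity
  have "(\<forall>j\<ge>1. AA x j = AA y j) \<longleftrightarrow> (\<forall>i. AA x (Suc i) = AA y (Suc i))"
  proof (intro iffI allI impI)
    show "AA x j = AA y j" if "\<forall>i. AA x (Suc i) = AA y (Suc i)" "1 \<le> j" for j
      using that by (cases j) auto
  qed simp
  then show ?thesis unfolding infinity FF_def enat.case AA_Suc_eq_iff by simp
qed

lemma FF_iff_levels_eq:
  assumes "1 \<le> n" and "x \<in> Xset n" "y \<in> Xset n"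
  shows "FF n x y \<longleftrightarrow> (\<forall>i. enat i < n \<longrightarrow> levels x i = levels y i)"
  unfolding FF_iff_range_aa_eq[OF assms]
proof (intro iffI allI impI)
  fix i assume "\<forall>i. enat i < n \<longrightarrow> range (aa x i) = range (aa y i)" and "enat i < n"
  then have "range (aa x j) = range (aa y j)" if "j \<le> i" for j
    using enat_le_less_trans that by blast
  then show "levels x i = levels y i" by (simp add: levels_eq_Union)
next
  fix i assume "\<forall>i. enat i < n \<longrightarrow> levels x i = levels y i" "enat i < n"
  then show "range (aa x i) = range (aa y i)"
    using range_aa_eq_levels_Int_of_rank assms(2,3) by metis
qed

context generic_labels
begin

definition generic_pt :: "(nat \<Rightarrow> nat \<Rightarrow> hs elem) \<Rightarrow> pt" where
  "generic_pt v = restrict (coding_pt v) {i. enat i < n}"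

lemma generic_pt_in_forced_sets:
  assumes "generic_enum B v" and "generic_pt v \<in> Xset n"
  shows "generic_pt v \<in> D t"
proof -
  obtain L where "forces n L (coding_pt v) (D t)" using assms(1) by (auto simp: generic_enum_def)
  moreover have "generic_pt v \<in> cylinder n L (coding_pt v)" by (simp add: generic_pt_def cylinder_def)
  ultimately have "forces n L (generic_pt v) (D t)" using forces_cong by blast
  then show ?thesis using assms(2) by (rule forces_imp_mem)
qed

lemma elems_eq_range_generic_enum:
  assumes "generic_enum B v"
  shows "elems (B i) = range (v i)"
  using assms by (simp add: generic_enum_def bij_betw_def)

lemma inj_coding_pt_row:
  assumes "tower B" and enum: "generic_enum B v"
  shows "inj (coding_pt v i)"
proof (rule injI)
  fix k l assume eq: "coding_pt v i k = coding_pt v i l"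
  have bounded: "v i m \<in> elems (level_bound B i)" for m
    using elems_mono[OF tower_subset_level_bound[OF assms(1)]] elems_eq_range_generic_enum[OF enum]
    by blast
  have "v i k = v i l"
  proof (cases i)
    case 0
    then show ?thesis using eq bounded by (intro inj_onD[OF inj_on_label]) auto
  next
    case (Suc j)
    then have "related (v j m) (v i k) = related (v j m) (v i l)" for m
      using fun_cong[OF eq, of m] by simp
    then show ?thesis
      using bounded Suc tower_nonempty[OF assms(1), of j] elems_eq_range_generic_enum[OF enum, of j]
      by (intro elem_eqI_related[of "B j"]) auto
  qed
  then show "k = l" using enum by (auto simp: generic_enum_def bij_betw_def dest: injD)
qed

lemma generic_pt_in_Xset:
  assumes "tower B" and enum: "generic_enum B v"
  shows "generic_pt v \<in> Xset n"
proof -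
  have "\<exists>l. related (v i k) (v (Suc i) l)" for i k
  proof -
    have "v i k \<in> elems (B (Suc i))"
      using elems_mono[OF tower_subset_Suc[OF assms(1)]] elems_eq_range_generic_enum[OF enum] by blast
    then obtain w where "w \<in> elems (B (Suc i))" "related (v i k) w"
      using elem_with_relations_ex[OF tower_nonempty[OF assms(1)], of "{}" "Suc i" "{v i k}" _ _ _ "\<lambda>_. True"]
      by auto
    then show ?thesis using elems_eq_range_generic_enum[OF enum] by auto
  qed
  moreover have "\<exists>k. related (v i k) (v (Suc i) l)" for i l
  proof -
    have "v (Suc i) l \<in> elems (next_level (B i))"
      using elems_mono[OF tower_subset_level_bound[OF assms(1), of "Suc i"]] elems_eq_range_generic_enum[OF enum]
      by auto
    then obtain u where "u \<in> elems (B i)" "related u (v (Suc i) l)"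
      using elem_with_relations_ex[OF tower_nonempty[OF assms(1)], of "{v (Suc i) l}" i "{}" _ _ "\<lambda>_. True"]
      by auto
    then show ?thesis using elems_eq_range_generic_enum[OF enum] by auto
  qed
  moreover have "enat i < n" if "enat (Suc i) < n" for i
    using that by (rule enat_le_less_trans[rotated]) simp
  ultimately show ?thesis
    by (simp add: Xset_iff generic_pt_def inj_eq[OF inj_coding_pt_row[OF assms]])
qed

lemma aa_coding_pt:
  assumes "generic_enum B v"
  shows "aa (coding_pt v) i k = interp B i (v i k)"
proof (induction i arbitrary: k)
  case (Suc i)
  then have "aa (coding_pt v) i ` {m. related (v i m) (v (Suc i) k)} =
      interp B i ` {u \<in> range (v i). related u (v (Suc i) k)}"
    by auto
  then show ?case by (simp add: aa_Suc elems_eq_range_generic_enum[OF assms])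
qed simp

lemma range_aa_generic_pt:
  assumes "generic_enum B v" and "enat i < n"
  shows "range (aa (generic_pt v) i) = coded_level B i"
proof -
  have "aa (generic_pt v) i k = interp B i (v i k)" for k
    by (simp add: generic_pt_def aa_restrict[OF assms(2)] aa_coding_pt[OF assms(1)])
  then show ?thesis
    by (simp add: coded_level_def elems_eq_range_generic_enum[OF assms(1)] image_image)
qed

lemma FF_generic_pt_iff:
  assumes n: "1 \<le> n" and xy: "x \<in> Xset n" "y \<in> Xset n"
    and enum: "generic_enum (levels x) u" "generic_enum (levels y) v"
  shows "FF n (generic_pt u) (generic_pt v) \<longleftrightarrow> FF n x y"
proof -
  have "FF n (generic_pt u) (generic_pt v) \<longleftrightarrow>
      (\<forall>i. enat i < n \<longrightarrow> coded_level (levels x) i = coded_level (levels y) i)"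
    using FF_iff_range_aa_eq[OF n] generic_pt_in_Xset[OF tower_levels] enum
    by (simp add: range_aa_generic_pt)
  also have "\<dots> \<longleftrightarrow> (\<forall>i. enat i < n \<longrightarrow> levels x i = levels y i)"
  proof (intro iffI allI impI)
    fix i assume "\<forall>i. enat i < n \<longrightarrow> levels x i = levels y i" and "enat i < n"
    then have "levels x j = levels y j" if "j \<le> i" for j
      using enat_le_less_trans that by blast
    then show "coded_level (levels x) i = coded_level (levels y) i"
      using interp_cong[of i "levels x" "levels y"] by (simp add: coded_level_def)
  next
    fix i assume "\<forall>i. enat i < n \<longrightarrow> coded_level (levels x) i = coded_level (levels y) i" "enat i < n"
    then show "levels x i = levels y i"
      using tower_eqI_coded_levels[OF tower_levels tower_levels] by blast
  qed
  finally show ?thesis using FF_iff_levels_eq[OF n xy] by simp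
qed

end

section \<open>Borel measurability\<close>

lemma pred_iff_borel_measurable: "Measurable.pred M P \<longleftrightarrow> P \<in> borel_measurable M"
  by (rule arg_cong[where f = "\<lambda>S. P \<in> S", OF measurable_cong_sets[OF refl]]) (simp add: sets_borel_eq_count_space)

lemma pred_pt_bit [measurable]: "Measurable.pred borel (\<lambda>x :: pt. x i k m)"
  unfolding pred_iff_borel_measurable using continuous_on_pt_bit
  by (rule borel_measurable_continuous_onI)

lemma borel_measurable_ptI:
  fixes f :: "'a \<Rightarrow> pt"
  assumes "\<And>i k m. Measurable.pred M (\<lambda>x. f x i k m)"
  shows "f \<in> borel_measurable M"
proof -
  have "(\<lambda>x. f x i k) \<in> borel_measurable M" for i k
    using assms unfolding pred_iff_borel_measurable by (rule measurable_coordinatewise_then_product)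
  then have "(\<lambda>x. f x i) \<in> borel_measurable M" for i
    by (rule measurable_coordinatewise_then_product)
  then show ?thesis
    by (rule measurable_coordinatewise_then_product)
qed

lemma pred_forces:
  assumes "\<And>i k m. Measurable.pred M (\<lambda>x. f x i k m)"
  shows "Measurable.pred M (\<lambda>x. forces n L (f x) W)"
  using pred_sets2[OF borel_open[OF open_forces[of n L W]] borel_measurable_ptI[of f M, OF assms]]
  by simp

lemma pred_compose_countable2:
  fixes f g :: "'a \<Rightarrow> 'b::countable"
  assumes "\<And>a b. Measurable.pred M (\<lambda>x. P x a b)"
    and f: "f \<in> measurable M (count_space UNIV)" and g: "g \<in> measurable M (count_space UNIV)"
  shows "Measurable.pred M (\<lambda>x. P x (f x) (g x))"
proof (rule measurable_compose_countable[where f = "\<lambda>b x. P x (f x) b", OF _ g])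
  show "Measurable.pred M (\<lambda>x. P x (f x) b)" for b
    using assms(1) by (rule measurable_compose_countable[where f = "\<lambda>a x. P x a b", OF _ f])
qed

lemma measurable_dependent_nat_choice:
  fixes s :: "'s::countable" and P :: "nat \<Rightarrow> 'a \<Rightarrow> 's \<Rightarrow> bool"
  assumes P_0: "\<And>x. P 0 x s"
    and P_Suc: "\<And>t x r. P t x r \<Longrightarrow> \<exists>r'. P (Suc t) x r' \<and> Q t x r r'"
    and [measurable]: "\<And>t r. Measurable.pred M (\<lambda>x. P t x r)" "\<And>t r r'. Measurable.pred M (\<lambda>x. Q t x r r')"
  shows "\<exists>f. (\<forall>t. f t \<in> measurable M (count_space UNIV)) \<and>
    (\<forall>x t. P t x (f t x)) \<and> (\<forall>x t. Q t x (f t x) (f (Suc t) x))"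
proof -
  define succ where "succ t x r e \<longleftrightarrow> P (Suc t) x (from_nat e) \<and> Q t x r (from_nat e)" for t x r e
  define f where "f = rec_nat (\<lambda>_. s) (\<lambda>t g x. from_nat (LEAST e. succ t x (g x) e))"
  have f_Suc: "f (Suc t) = (\<lambda>x. from_nat (LEAST e. succ t x (f t x) e))" for t
    by (simp add: f_def)
  have "f t \<in> measurable M (count_space UNIV)" for t
  proof (induction t)
    case 0
    show ?case by (simp add: f_def)
  next
    case (Suc t)
    have "Measurable.pred M (\<lambda>x. succ t x r e)" for r e
      unfolding succ_def by measurable
    then have "Measurable.pred M (\<lambda>x. succ t x (f t x) e)" for e
      by (rule measurable_compose_countable[where f = "\<lambda>r x. succ t x r e", OF _ Suc])
    then have "(\<lambda>x. LEAST e. succ t x (f t x) e) \<in> measurable M (count_space UNIV)"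
      by (rule measurable_Least)
    then show ?case unfolding f_Suc by (rule measurable_compose) simp
  qed
  moreover have succ_f: "P (Suc t) x (f (Suc t) x) \<and> Q t x (f t x) (f (Suc t) x)"
    if "P t x (f t x)" for t x
  proof -
    obtain r where "P (Suc t) x r" "Q t x (f t x) r" using P_Suc \<open>P t x (f t x)\<close> by blast
    then have "succ t x (f t x) (to_nat r)" by (simp add: succ_def)
    then have "succ t x (f t x) (LEAST e. succ t x (f t x) e)" by (rule LeastI)
    then show ?thesis by (simp add: succ_def f_Suc)
  qed
  moreover have "P t x (f t x)" for t x
    by (induction t) (use P_0 succ_f in \<open>auto simp: f_def\<close>)
  ultimately show ?thesis by blast
qed

lemma pred_aa_eq [measurable]: "Measurable.pred borel (\<lambda>x. aa x i k = aa x j l)"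
proof (induction i arbitrary: j k l)
  case 0
  have "Measurable.pred borel (\<lambda>x :: pt. \<forall>m. x 0 k m = x 0 l m)" by measurable
  then show ?case by (cases j) (simp_all add: fun_eq_iff)
next
  case (Suc i)
  note Suc.IH [measurable]
  have [measurable]: "Measurable.pred borel (\<lambda>x. aa x j l = aa x i k)" for j k l
    by (subst eq_commute) (rule Suc.IH)
  show ?case
  proof (cases j)
    case (Suc j')
    show ?thesis
      unfolding Suc aa_Suc_eq_iff set_eq_subset image_subset_iff image_iff Ball_def Bex_def mem_Collect_eq
      by measurable
  qed simp
qed

lemma pred_hmem [measurable]: "Measurable.pred borel (\<lambda>x. hmem (aa x i k) (aa x j l))"
  by (cases j) (simp_all add: hmem_aa_Suc)

lemma pred_atom_bit [measurable]: "Measurable.pred borel (\<lambda>x. atom_bit (aa x i k) j)"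
  by (cases i) (simp_all add: aa_Suc)

text \<open>Naming elements over indices makes the stages of the enumeration range over a countable type.\<close>
type_synonym name = "(nat \<times> nat) elem"

definition denote :: "pt \<Rightarrow> name \<Rightarrow> hs elem" where
  "denote x = map_elem (case_prod (aa x))"

lemma support_denote [simp]: "support (denote x a) = map (case_prod (aa x)) (support a)"
  by (simp add: denote_def elem.map_sel)

lemma code_denote [simp]: "code (denote x a) = code a"
  by (simp add: denote_def elem.map_sel)

lemma elems_levels_subset_range_denote: "elems (levels x i) \<subseteq> range (denote x)"
  unfolding levels_def elems_image denote_def by blast

lemma pred_case_prod_aa_eq [measurable]: "Measurable.pred borel (\<lambda>x. case_prod (aa x) p = case_prod (aa x) q)"
  by (simp add: split_beta)

lemma pred_hmem_case_prod_aa [measurable]: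
  "Measurable.pred borel (\<lambda>x. hmem (case_prod (aa x) p) (case_prod (aa x) q))"
  by (simp add: split_beta)

lemma pred_denote_eq [measurable]: "Measurable.pred borel (\<lambda>x. denote x a = denote x b)"
proof -
  have "denote x a = denote x b \<longleftrightarrow> code a = code b \<and> length (support a) = length (support b) \<and>
      (\<forall>r<length (support a). case_prod (aa x) (support a ! r) = case_prod (aa x) (support b ! r))"
    for x
    by (auto simp: list_eq_iff_nth_eq elem.expand dest: arg_cong[of _ _ code] arg_cong[of _ _ support])
  then show ?thesis by simp
qed

lemma pred_denote_in_elems_levels [measurable]: "Measurable.pred borel (\<lambda>x. denote x a \<in> elems (levels x i))"
proof -
  have mem_iff: "denote x a \<in> elems (levels x i) \<longleftrightarrow>
      (\<forall>p\<in>set (support a). \<exists>j\<le>i. \<exists>l. case_prod (aa x) p = case_prod (aa x) (j, l))" for x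
    unfolding elems_def levels_def by (auto simp: subset_iff image_iff Bex_def)
  show ?thesis unfolding mem_iff by measurable
qed

lemma pred_cross_pattern [measurable]:
  "Measurable.pred borel (\<lambda>x. cross_pattern (support (denote x a)) (support (denote x b)) = p)"
proof -
  have "cross_pattern (support (denote x a)) (support (denote x b)) = p \<longleftrightarrow>
      length p = length (support a) \<and> (\<forall>r<length (support a). length (p ! r) = length (support b) \<and>
        (\<forall>s<length (support b).
          fst (p ! r ! s) = (case_prod (aa x) (support a ! r) = case_prod (aa x) (support b ! s)) \<and>
          snd (p ! r ! s) = hmem (case_prod (aa x) (support a ! r)) (case_prod (aa x) (support b ! s))))"
    for x
    by (auto simp: cross_pattern_def trace_def list_eq_iff_nth_eq prod_eq_iff)
  then show ?thesis by simp
qed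

lemma pred_related [measurable]: "Measurable.pred borel (\<lambda>x. related (denote x a) (denote x b))"
proof -
  have related_iff: "related (denote x a) (denote x b) \<longleftrightarrow>
      (\<exists>p. related_codes (code a) (code b) p \<and> cross_pattern (support (denote x a)) (support (denote x b)) = p)"
    for x
    by (simp add: related_def)
  show ?thesis unfolding related_iff by measurable
qed

lemma pred_elem_bits: "Measurable.pred borel (\<lambda>x. elem_bits (denote x a) b)"
proof (cases "from_nat b :: (nat \<times> nat) + (nat \<times> nat)")
  case (Inl p)
  then show ?thesis by (simp add: elem_bits_def)
next
  case (Inr q)
  obtain i j where q: "q = (i, j)" by (cases q)
  have "elem_bits (denote x a) b \<longleftrightarrow> i < length (support a) \<and> atom_bit (case_prod (aa x) (support a ! i)) j"
    for x
    by (auto simp: elem_bits_def Inr q)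
  then show ?thesis by (simp add: split_beta)
qed

definition named_enum :: "pt \<Rightarrow> name list list \<Rightarrow> nat \<Rightarrow> nat \<Rightarrow> hs elem" where
  "named_enum x s = (\<lambda>i k. denote x (s ! i ! k))"

lemma named_enum_ex:
  assumes "partial_enum (levels x) (grid L) v"
  shows "\<exists>s. length s = L \<and> extends_on (grid L) v (named_enum x s)"
proof -
  have "\<exists>a. denote x a = v i k" if "i < L" "k < L" for i k
    using partial_enum_mem[OF assms, of i k] elems_levels_subset_range_denote that by fastforce
  then obtain a where a: "\<And>i k. i < L \<Longrightarrow> k < L \<Longrightarrow> denote x (a i k) = v i k" by metis
  show ?thesis
    using a
    by (intro exI[of _ "map (\<lambda>i. map (a i) [0..<L]) [0..<L]"]) (simp add: extends_on_def named_enum_def)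
qed

definition target :: "pt \<Rightarrow> nat \<Rightarrow> nat \<times> hs elem" where
  "target x t = map_prod id (denote x) (from_nat t)"

lemma pred_partial_enum: "Measurable.pred borel (\<lambda>x. partial_enum (levels x) P (named_enum x s))"
  unfolding partial_enum_def named_enum_def by measurable

context generic_labels
begin

lemma pred_label: "Measurable.pred borel (\<lambda>x. label (denote x a) m)"
proof -
  have "(\<lambda>x. elem_bits (denote x a)) \<in> borel_measurable borel"
    using pred_elem_bits unfolding pred_iff_borel_measurable
    by (intro measurable_coordinatewise_then_product)
  then have "(\<lambda>x. \<phi> (elem_bits (denote x a)) m) \<in> borel_measurable borel"
    using continuous_on_product_then_coordinatewise[OF continuous_labels]
    by (rule measurable_compose[OF _ borel_measurable_continuous_onI])
  then show ?thesis
    by (simp add: label_def overwrite_def pred_iff_borel_measurable)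
qed

lemma pred_coding_pt:
  assumes names: "\<And>i k. (\<lambda>x. e x i k) \<in> measurable borel (count_space UNIV)"
  shows "Measurable.pred borel (\<lambda>x. coding_pt (\<lambda>i k. denote x (e x i k)) i k m)"
proof (cases i)
  case 0
  show ?thesis
    unfolding 0 coding_pt.simps
    using pred_label
    by (rule measurable_compose_countable[where f = "\<lambda>a x. label (denote x a) m", OF _ names])
next
  case (Suc j)
  show ?thesis
    unfolding Suc coding_pt.simps
    using pred_related names names by (rule pred_compose_countable2)
qed

definition named_step :: "nat \<Rightarrow> pt \<Rightarrow> name list list \<Rightarrow> name list list \<Rightarrow> bool" where
  "named_step t x s s' \<longleftrightarrow>
     generic_step (levels x) t (target x t) (length s) (named_enum x s) (length s') (named_enum x s')"

lemma generic_step_cong: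
  assumes "extends_on (grid L') v' w" and "generic_step B t g L v L' v'"
  shows "generic_step B t g L v L' w"
proof -
  have "forces n L' (coding_pt w) (D t)"
    using assms(2) forces_coding_pt_cong[OF assms(1)] by (simp add: generic_step_def)
  moreover have "extends_on (grid L) v w"
    using extends_on_trans[OF _ assms(1) grid_mono] assms(2) by (simp add: generic_step_def)
  ultimately show ?thesis
    using assms(2) extends_on_image_mono[OF assms(1) subset_refl] by (auto simp: generic_step_def)
qed

lemma named_step_ex:
  assumes "partial_enum (levels x) (grid (length s)) (named_enum x s)"
  shows "\<exists>s'. partial_enum (levels x) (grid (length s')) (named_enum x s') \<and> named_step t x s s'"
proof -
  obtain L' v' where v': "partial_enum (levels x) (grid L') v'"
    "generic_step (levels x) t (target x t) (length s) (named_enum x s) L' v'"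
    using generic_step_ex[OF tower_levels assms] by blast
  obtain s' where s': "length s' = L'" "extends_on (grid L') v' (named_enum x s')"
    using named_enum_ex[OF v'(1)] by blast
  have "partial_enum (levels x) (grid L') (named_enum x s')"
    using s'(2) v'(1) by (rule partial_enum_cong)
  then show ?thesis
    using generic_step_cong[OF s'(2) v'(2)] s'(1) by (auto simp: named_step_def)
qed

lemma pred_named_step: "Measurable.pred borel (\<lambda>x. named_step t x s s')"
proof -
  have [measurable]: "Measurable.pred borel (\<lambda>x. forces n L (coding_pt (\<lambda>i k. denote x (s' ! i ! k))) (D t))"
    for L
    by (intro pred_forces pred_coding_pt) simp
  obtain i a where "from_nat t = (i :: nat, a :: name)" by (cases "from_nat t :: nat \<times> name")
  then have target: "target x t = (i, denote x a)" for x by (simp add: target_def)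
  show ?thesis
    unfolding named_step_def generic_step_def target fst_conv snd_conv extends_on_def named_enum_def
      image_iff Image_singleton_iff Bex_def
    by measurable
qed

lemma measurable_generic_enum_ex:
  "\<exists>e. (\<forall>i k. (\<lambda>x. e x i k) \<in> measurable borel (count_space UNIV)) \<and>
    (\<forall>x. generic_enum (levels x) (\<lambda>i k. denote x (e x i k)))"
proof -
  let ?P = "\<lambda>_ :: nat. \<lambda>x s. partial_enum (levels x) (grid (length s)) (named_enum x s)"
  have "\<exists>f. (\<forall>t. f t \<in> measurable borel (count_space UNIV)) \<and> (\<forall>x t. ?P t x (f t x)) \<and>
      (\<forall>x t. named_step t x (f t x) (f (Suc t) x))"
  proof (rule measurable_dependent_nat_choice[where P = ?P])
    show "?P 0 x []" for x by (simp add: partial_enum_def)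
  qed (fact named_step_ex pred_partial_enum pred_named_step)+
  then obtain f where f: "\<And>t. f t \<in> measurable borel (count_space UNIV)"
    "\<And>x t. partial_enum (levels x) (grid (length (f t x))) (named_enum x (f t x))"
    "\<And>x t. named_step t x (f t x) (f (Suc t) x)"
    by blast
  define e where "e x i k = f (Suc (i + k)) x ! i ! k" for x i k
  have "(\<lambda>x. e x i k) \<in> measurable borel (count_space UNIV)" for i k
    unfolding e_def by (rule measurable_compose[OF f(1)]) simp
  moreover have "generic_enum (levels x) (\<lambda>i k. denote x (e x i k))" for x
  proof -
    have targets: "(i, v) \<in> range (target x)" if v: "v \<in> elems (levels x i)" for i v
    proof -
      obtain a where "v = denote x a" using elems_levels_subset_range_denote v by blast
      then have "(i, v) = target x (to_nat (i, a))" by (simp add: target_def)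
      then show ?thesis by blast
    qed
    have "generic_enum (levels x) (\<lambda>i k. named_enum x (f (Suc (i + k)) x) i k)"
      using f(2,3)[where x = x] targets unfolding named_step_def by (rule generic_enum_limit)
    then show ?thesis by (simp add: named_enum_def e_def)
  qed
  ultimately show ?thesis by blast
qed

lemma borel_reducible_if_Inter_subset:
  assumes "1 \<le> n" and "(\<Inter>t. D t) \<subseteq> C"
  shows "borel_reducible (Xtop n) (FF n) (subtopology (Xtop n) C) (FF n)"
proof -
  obtain e where e: "\<And>i k. (\<lambda>x. e x i k) \<in> measurable borel (count_space UNIV)"
    and enum: "\<And>x. generic_enum (levels x) (\<lambda>i k. denote x (e x i k))"
    using measurable_generic_enum_ex by blast
  define f where "f x = generic_pt (\<lambda>i k. denote x (e x i k))" for x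
  have "Measurable.pred borel (\<lambda>x. f x i k m)" for i k m
  proof (cases "enat i < n")
    case True
    have "Measurable.pred borel (\<lambda>x. coding_pt (\<lambda>i k. denote x (e x i k)) i k m)"
      using e by (rule pred_coding_pt)
    then show ?thesis using True by (simp add: f_def generic_pt_def)
  qed (simp add: f_def generic_pt_def)
  then have "f \<in> borel_measurable borel" by (rule borel_measurable_ptI)
  moreover have f_Xset: "f x \<in> Xset n" for x
    unfolding f_def using tower_levels enum by (rule generic_pt_in_Xset)
  moreover have "f x \<in> C" for x
    using generic_pt_in_forced_sets[OF enum] f_Xset assms(2) by (auto simp: f_def)
  ultimately have "borel_map (Xtop n) (subtopology (Xtop n) C) f"
    unfolding Xtop_eq subtopology_subtopology by (intro borel_map_top_of_set) auto
  moreover have "FF n x y \<longleftrightarrow> FF n (f x) (f y)" if "x \<in> Xset n" "y \<in> Xset n" for x y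
    unfolding f_def FF_generic_pt_iff[OF assms(1) that enum enum] ..
  ultimately show ?thesis by (auto simp: borel_reducible_def Xtop_eq)
qed

end

theorem theorem5p1:
  fixes n :: enat and C :: "pt set"
  assumes "1 \<le> n"
    and "comeager_in (Xtop n) C"
  shows "borel_reducible (Xtop n) (FF n) (subtopology (Xtop n) C) (FF n)"
proof -
  obtain D :: "nat \<Rightarrow> pt set" where D: "\<And>t. openin (Xtop n) (D t)"
    "\<And>t. Xtop n closure_of D t = topspace (Xtop n)" and "(\<Inter>t. D t) \<subseteq> C"
    using comeager_in_contains_Inter_dense_open[OF assms(2)] by blast
  obtain \<phi> where "generic_labels n D \<phi>"
    using generic_labels_ex[where D = D, OF D] by blast
  then interpret generic_labels n D \<phi> .
  show ?thesis using assms(1) \<open>(\<Inter>t. D t) \<subseteq> C\<close> by (rule borel_reducible_if_Inter_subset)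
qed

end
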